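(* For all $n\ge2$, $0\le k\le n-2$, $J\subset[1,k]$ with $J=k+1-J$, and $K\subset[n+k+2,2n-1]$ with $K=3n+k+1-K$, the assignments $$\widehat T_1\mapsto T_{w_\circ^{[1,n+k]\cup K}},\qquad\widehat T_2\mapsto T_{w_\circ^{[k+2,2n-1]\cup J}}$$ define a homomorphism of monoids $\mathrm{Br}^+(B_2)\to\mathrm{Br}^+_{2n}$.
   Context: $[a,b]=\{i\in\mathbb Z:a\le i\le b\}$ (empty if $a>b$); $c-J=\{c-j:j\in J\}$. $\mathrm{Br}^+(B_2)$ is the monoid with generators $\widehat T_1,\widehat T_2$ and the relation $(\widehat T_1\widehat T_2)^2=(\widehat T_2\widehat T_1)^2$. $\mathrm{Br}^+_{N}$ is the braid monoid on $N$ strands: generators $T_1,\dots,T_{N-1}$, relations $T_iT_j=T_jT_i$ for $|i-j|>1$ and $T_iT_jT_i=T_jT_iT_j$ for $|i-j|=1$. The associated Coxeter group is the symmetric group $S_N$ with simple generators $s_i=(i,i+1)$. For $w\in S_N$, $T_w=T_{i_1}\cdots T_{i_r}$ for any reduced expression $w=s_{i_1}\cdots s_{i_r}$. For $L\subset[1,N-1]$, $w_\circ^L$ is the longest element of the parabolic subgroup $\langle s_l:l\in L\rangle$. *)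

theory Defs
  imports "HOL-Algebra.Sym_Groups" "HOL-Combinatorics.Transposition"
begin

section \<open>Monoids given by generators and relations\<close>

text \<open>The congruence on the free monoid \<open>lists S\<close> generated by a set \<open>R\<close> of pairs of words.\<close>

inductive_set pres_cong :: "'a set \<Rightarrow> ('a list \<times> 'a list) set \<Rightarrow> ('a list \<times> 'a list) set"
  for S :: "'a set" and R :: "('a list \<times> 'a list) set"
where
  refl: "u \<in> lists S \<Longrightarrow> (u, u) \<in> pres_cong S R"
| sym: "(u, v) \<in> pres_cong S R \<Longrightarrow> (v, u) \<in> pres_cong S R"
| trans: "(u, v) \<in> pres_cong S R \<Longrightarrow> (v, w) \<in> pres_cong S R \<Longrightarrow> (u, w) \<in> pres_cong S R"
| rel: "(a, b) \<in> R \<Longrightarrow> a \<in> lists S \<Longrightarrow> b \<in> lists S \<Longrightarrow> u \<in> lists S \<Longrightarrow> v \<in> lists S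
    \<Longrightarrow> (u @ a @ v, u @ b @ v) \<in> pres_cong S R"

definition word_class :: "'a set \<Rightarrow> ('a list \<times> 'a list) set \<Rightarrow> 'a list \<Rightarrow> 'a list set" where
  "word_class S R u = pres_cong S R `` {u}"

definition presented_monoid :: "'a set \<Rightarrow> ('a list \<times> 'a list) set \<Rightarrow> 'a list set monoid" where
  "presented_monoid S R =
    \<lparr> carrier = lists S // pres_cong S R,
      mult = (\<lambda>A B. \<Union>x\<in>A. \<Union>y\<in>B. word_class S R (x @ y)),
      one = word_class S R [] \<rparr>"

lemma pres_cong_lists: "(u, v) \<in> pres_cong S R \<Longrightarrow> u \<in> lists S \<and> v \<in> lists S"
  by (induction rule: pres_cong.induct) auto

lemma equiv_pres_cong: "equiv (lists S) (pres_cong S R)"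
proof (rule equivI)
  show "pres_cong S R \<subseteq> lists S \<times> lists S"
    using pres_cong_lists by fastforce
  show "refl_on (lists S) (pres_cong S R)"
    by (rule refl_onI) (rule pres_cong.refl)
  show "Relation.sym (pres_cong S R)"
    by (rule symI) (rule pres_cong.sym)
  show "Relation.trans (pres_cong S R)"
    by (rule transI) (rule pres_cong.trans)
qed

lemma pres_cong_append_left:
  "(u, v) \<in> pres_cong S R \<Longrightarrow> w \<in> lists S \<Longrightarrow> (w @ u, w @ v) \<in> pres_cong S R"
proof (induction rule: pres_cong.induct)
  case (rel a b u v)
  then show ?case using pres_cong.rel[of a b R S "w @ u" v] by simp
next
  case (refl u)
  then show ?case by (intro pres_cong.refl) simp
next
  case (sym u v)
  then show ?case by (blast intro: pres_cong.sym)
next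
  case (trans u v z)
  then show ?case by (blast intro: pres_cong.trans)
qed

lemma pres_cong_append_right:
  "(u, v) \<in> pres_cong S R \<Longrightarrow> w \<in> lists S \<Longrightarrow> (u @ w, v @ w) \<in> pres_cong S R"
proof (induction rule: pres_cong.induct)
  case (rel a b u v)
  then show ?case using pres_cong.rel[of a b R S u "v @ w"] by simp
next
  case (refl u)
  then show ?case by (intro pres_cong.refl) simp
next
  case (sym u v)
  then show ?case by (blast intro: pres_cong.sym)
next
  case (trans u v z)
  then show ?case by (blast intro: pres_cong.trans)
qed

lemma pres_cong_append:
  assumes "(u, u') \<in> pres_cong S R" "(v, v') \<in> pres_cong S R"
  shows "(u @ v, u' @ v') \<in> pres_cong S R"
proof (rule pres_cong.trans)
  show "(u @ v, u' @ v) \<in> pres_cong S R"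
    using assms by (intro pres_cong_append_right) (auto dest: pres_cong_lists)
  show "(u' @ v, u' @ v') \<in> pres_cong S R"
    using assms by (intro pres_cong_append_left) (auto dest: pres_cong_lists)
qed

lemma word_class_eq_iff:
  assumes "u \<in> lists S" "v \<in> lists S"
  shows "word_class S R u = word_class S R v \<longleftrightarrow> (u, v) \<in> pres_cong S R"
  unfolding word_class_def using eq_equiv_class_iff[OF equiv_pres_cong assms] by blast

lemma carrier_presented_monoid:
  "carrier (presented_monoid S R) = word_class S R ` lists S"
  unfolding presented_monoid_def word_class_def quotient_def by auto

lemma mult_presented_monoid:
  assumes "u \<in> lists S" "v \<in> lists S"
  shows "word_class S R u \<otimes>\<^bsub>presented_monoid S R\<^esub> word_class S R v = word_class S R (u @ v)"
proof -
  have "word_class S R (x @ y) = word_class S R (u @ v)"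
    if "x \<in> word_class S R u" "y \<in> word_class S R v" for x y
  proof -
    from that have "(u @ v, x @ y) \<in> pres_cong S R"
      unfolding word_class_def by (auto intro: pres_cong_append)
    then show ?thesis
      using word_class_eq_iff[of "u @ v" S "x @ y" R] pres_cong_lists[of "u @ v" "x @ y" S R] by simp
  qed
  moreover have "u \<in> word_class S R u" "v \<in> word_class S R v"
    using assms unfolding word_class_def by (auto intro: pres_cong.refl)
  ultimately have "(\<Union>x\<in>word_class S R u. \<Union>y\<in>word_class S R v. word_class S R (x @ y))
      = word_class S R (u @ v)"
    by blast
  then show ?thesis
    by (simp add: presented_monoid_def)
qed

lemma one_presented_monoid: "\<one>\<^bsub>presented_monoid S R\<^esub> = word_class S R []"
  by (simp add: presented_monoid_def)

lemma monoid_presented_monoid: "monoid (presented_monoid S R)"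
proof (rule monoidI)
  have app: "u @ v \<in> lists S" if "u \<in> lists S" "v \<in> lists S" for u v
    using that by simp
  show "x \<otimes>\<^bsub>presented_monoid S R\<^esub> y \<in> carrier (presented_monoid S R)"
    if "x \<in> carrier (presented_monoid S R)" "y \<in> carrier (presented_monoid S R)" for x y
    using that unfolding carrier_presented_monoid
    by (elim imageE) (simp only: mult_presented_monoid imageI app)
  show "\<one>\<^bsub>presented_monoid S R\<^esub> \<in> carrier (presented_monoid S R)"
    unfolding carrier_presented_monoid one_presented_monoid by (intro imageI) simp
  show "x \<otimes>\<^bsub>presented_monoid S R\<^esub> y \<otimes>\<^bsub>presented_monoid S R\<^esub> z
      = x \<otimes>\<^bsub>presented_monoid S R\<^esub> (y \<otimes>\<^bsub>presented_monoid S R\<^esub> z)"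
    if "x \<in> carrier (presented_monoid S R)" "y \<in> carrier (presented_monoid S R)"
      "z \<in> carrier (presented_monoid S R)" for x y z
    using that unfolding carrier_presented_monoid
    by (elim imageE) (simp only: mult_presented_monoid app append_assoc)
  show "\<one>\<^bsub>presented_monoid S R\<^esub> \<otimes>\<^bsub>presented_monoid S R\<^esub> x = x"
    if "x \<in> carrier (presented_monoid S R)" for x
    using that unfolding carrier_presented_monoid one_presented_monoid
    by (elim imageE) (simp only: mult_presented_monoid lists.Nil append_Nil)
  show "x \<otimes>\<^bsub>presented_monoid S R\<^esub> \<one>\<^bsub>presented_monoid S R\<^esub> = x"
    if "x \<in> carrier (presented_monoid S R)" for x
    using that unfolding carrier_presented_monoid one_presented_monoid
    by (elim imageE) (simp only: mult_presented_monoid lists.Nil append_Nil2)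
qed


section \<open>The positive braid monoids of types \<open>B\<^sub>2\<close> and \<open>A\<^sub>N\<^sub>-\<^sub>1\<close>\<close>

definition B2_rels :: "(nat list \<times> nat list) set" where
  "B2_rels = {([1, 2, 1, 2], [2, 1, 2, 1])}"

definition Br_B2 :: "nat list set monoid" where
  "Br_B2 = presented_monoid {1, 2} B2_rels"

definition T_hat :: "nat \<Rightarrow> nat list set" where
  "T_hat i = word_class {1, 2} B2_rels [i]"

definition braid_rels :: "nat \<Rightarrow> (nat list \<times> nat list) set" where
  "braid_rels N =
     {([i, j], [j, i]) | i j. i \<in> {1..N-1} \<and> j \<in> {1..N-1} \<and> \<bar>int i - int j\<bar> > 1} \<union>
     {([i, j, i], [j, i, j]) | i j. i \<in> {1..N-1} \<and> j \<in> {1..N-1} \<and> \<bar>int i - int j\<bar> = 1}"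

definition Br :: "nat \<Rightarrow> nat list set monoid" where
  "Br N = presented_monoid {1..N-1} (braid_rels N)"


section \<open>The Coxeter group \<open>S\<^sub>N\<close>\<close>

definition simple_refl :: "nat \<Rightarrow> nat \<Rightarrow> nat" where
  "simple_refl i = transpose i (i + 1)"

definition perm_of_word :: "nat \<Rightarrow> nat list \<Rightarrow> nat \<Rightarrow> nat" where
  "perm_of_word N u = foldr (\<lambda>i w. simple_refl i \<otimes>\<^bsub>sym_group N\<^esub> w) u \<one>\<^bsub>sym_group N\<^esub>"

definition cox_length :: "nat \<Rightarrow> (nat \<Rightarrow> nat) \<Rightarrow> nat" where
  "cox_length N w = (LEAST r. \<exists>u \<in> lists {1..N-1}. length u = r \<and> perm_of_word N u = w)"

definition reduced_expr :: "nat \<Rightarrow> (nat \<Rightarrow> nat) \<Rightarrow> nat list \<Rightarrow> bool" where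
  "reduced_expr N w u \<longleftrightarrow>
     u \<in> lists {1..N-1} \<and> perm_of_word N u = w \<and> length u = cox_length N w"

text \<open>By Matsumoto's theorem the class does not depend on the reduced expression chosen.\<close>

definition T_lift :: "nat \<Rightarrow> (nat \<Rightarrow> nat) \<Rightarrow> nat list set" where
  "T_lift N w = word_class {1..N-1} (braid_rels N) (SOME u. reduced_expr N w u)"

definition parabolic :: "nat \<Rightarrow> nat set \<Rightarrow> (nat \<Rightarrow> nat) set" where
  "parabolic N L = generate (sym_group N) (simple_refl ` L)"

text \<open>The length function attains its maximum on a parabolic subgroup exactly once.\<close>

definition longest_elt :: "nat \<Rightarrow> nat set \<Rightarrow> nat \<Rightarrow> nat" where
  "longest_elt N L = (ARG_MAX (cox_length N) w. w \<in> parabolic N L)"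


section \<open>Monoid homomorphisms\<close>

text \<open>The library's \<^const>\<open>hom\<close> does not require preservation of the unit. Extensionality makes
  a homomorphism determined by its values on the carrier.\<close>

definition monoid_hom :: "('a, 'c) monoid_scheme \<Rightarrow> ('b, 'd) monoid_scheme \<Rightarrow> ('a \<Rightarrow> 'b) set" where
  "monoid_hom M N =
     {\<phi> \<in> hom M N. \<phi> \<one>\<^bsub>M\<^esub> = \<one>\<^bsub>N\<^esub> \<and> \<phi> \<in> extensional (carrier M)}"

end

theory Submission
  imports Defs
begin

text \<open>Put \<open>p = k + 1\<close> and \<open>q = n - p\<close> and cut the \<open>2n\<close> strands into four consecutive blocks
  \<open>P\<^sub>1, Q\<^sub>1, P\<^sub>2, Q\<^sub>2\<close> of sizes \<open>p, q, p, q\<close>. For \<open>J = K = {}\<close> the two elements are the half twists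
  \<open>a\<close> of \<open>P\<^sub>1Q\<^sub>1P\<^sub>2\<close> and \<open>b\<close> of \<open>Q\<^sub>1P\<^sub>2Q\<^sub>2\<close>. Write \<open>t\<close>, \<open>t'\<close> for the half twists of
  \<open>P\<^sub>1Q\<^sub>1\<close> and \<open>P\<^sub>2Q\<^sub>2\<close>, and \<open>\<chi>\<close> for the positive crossing of these two halves. Splitting each of
  \<open>a\<close> and \<open>b\<close> into half twists of blocks and a block crossing gives \<open>ab = t P\<^sub>2 Q\<^sub>2 t \<chi>\<close> and
  \<open>ba = Q\<^sub>1 t' t' P\<^sub>1 \<chi>\<close>, where a block stands for its half twist. Since \<open>\<chi>\<close> exchanges the halves
  and \<open>t\<^sup>2\<close>, \<open>t'\<^sup>2\<close> are central in theirs, both \<open>abab\<close> and \<open>baba\<close> equal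
  \<open>t\<^sup>2 P\<^sub>1 Q\<^sub>1 t'\<^sup>2 P\<^sub>2 Q\<^sub>2 \<chi>\<^sup>2\<close>; no cancellation is needed. For general \<open>J\<close>, \<open>K\<close> the extra factors
  pass through \<open>a\<close> and \<open>b\<close> by reflection of the generators, and by the symmetry of \<open>J\<close> and \<open>K\<close> the
  same four commuting factors come out of both sides.\<close>

section \<open>Inversions and Matsumoto's theorem\<close>

definition inversions :: "nat \<Rightarrow> (nat \<Rightarrow> nat) \<Rightarrow> (nat \<times> nat) set" where
  "inversions N w = {(x, y). 1 \<le> x \<and> x < y \<and> y \<le> N \<and> w y < w x}"

definition inv_count :: "nat \<Rightarrow> (nat \<Rightarrow> nat) \<Rightarrow> nat" where
  "inv_count N w = card (inversions N w)"

text \<open>No pair is inverted by \<open>v\<close> and then back by \<open>u\<close>; this is additivity of the lengths.\<close>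

definition len_add :: "nat \<Rightarrow> (nat \<Rightarrow> nat) \<Rightarrow> (nat \<Rightarrow> nat) \<Rightarrow> bool" where
  "len_add N u v \<longleftrightarrow>
     (\<forall>x y. 1 \<le> x \<longrightarrow> x < y \<longrightarrow> y \<le> N \<longrightarrow> v y < v x \<longrightarrow> u (v y) < u (v x))"

lemma finite_inversions [simp]: "finite (inversions N w)"
  by (rule finite_subset[of _ "{1..N} \<times> {1..N}"]) (auto simp: inversions_def)

lemma inv_count_id [simp]: "inv_count N id = 0" "inv_count N (\<lambda>x. x) = 0"
proof -
  have "inversions N (\<lambda>x. x) = {}" by (auto simp: inversions_def)
  then show "inv_count N (\<lambda>x. x) = 0" "inv_count N id = 0" by (simp_all add: inv_count_def id_def)
qed

text \<open>The inversions of \<open>v\<close> survive by \<open>len_add\<close>. The remaining ones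
  of \<open>u \<circ> v\<close> are pairs kept in order by \<open>v\<close>, and \<open>v\<close>
  maps these bijectively onto the inversions of \<open>u\<close>.\<close>

lemma inv_count_comp:
  assumes u: "u permutes {1..N}" and v: "v permutes {1..N}" and la: "len_add N u v"
  shows "inv_count N (u \<circ> v) = inv_count N u + inv_count N v"
proof -
  have sub: "inversions N v \<subseteq> inversions N (u \<circ> v)"
    using la by (auto simp: inversions_def len_add_def)
  have "bij_betw (\<lambda>(x, y). (v x, v y)) (inversions N (u \<circ> v) - inversions N v) (inversions N u)"
  proof (rule bij_betw_imageI)
    show "inj_on (\<lambda>(x, y). (v x, v y)) (inversions N (u \<circ> v) - inversions N v)"
      using permutes_inj[OF v] by (auto simp: inj_on_def)
    show "(\<lambda>(x, y). (v x, v y)) ` (inversions N (u \<circ> v) - inversions N v) = inversions N u"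
    proof (intro equalityI subsetI)
      fix z assume "z \<in> (\<lambda>(x, y). (v x, v y)) ` (inversions N (u \<circ> v) - inversions N v)"
      then obtain x y where z: "z = (v x, v y)" and xy: "1 \<le> x" "x < y" "y \<le> N"
        "u (v y) < u (v x)" "\<not> v y < v x"
        by (auto simp: inversions_def)
      have "v x \<noteq> v y" using xy by auto
      moreover have "v x \<in> {1..N}" "v y \<in> {1..N}"
        using xy permutes_in_image[OF v] by auto
      ultimately show "z \<in> inversions N u" using xy z by (auto simp: inversions_def)
    next
      fix z assume "z \<in> inversions N u"
      then obtain c d where z: "z = (c, d)" and cd: "1 \<le> c" "c < d" "d \<le> N" "u d < u c"
        by (auto simp: inversions_def)
      have "c \<in> v ` {1..N}" "d \<in> v ` {1..N}"
        using cd permutes_image[OF v] by auto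
      then obtain x y where x: "x \<in> {1..N}" "c = v x" and y: "y \<in> {1..N}" "d = v y" by blast
      \<comment> \<open>In the opposite order the preimages would form an inversion of
        \<open>v\<close> that \<open>u\<close> undoes, against \<open>len_add\<close>.\<close>
      have "x < y"
      proof (rule ccontr)
        assume "\<not> x < y"
        then have "y < x" using x y cd by (metis linorder_neqE_nat less_irrefl)
        then have "u (v x) < u (v y)" using la x y cd by (auto simp: len_add_def)
        then show False using cd x y by simp
      qed
      then have "(x, y) \<in> inversions N (u \<circ> v) - inversions N v"
        using cd x y by (auto simp: inversions_def)
      then show "z \<in> (\<lambda>(x, y). (v x, v y)) ` (inversions N (u \<circ> v) - inversions N v)"
        using z x y by force
    qed
  qed
  then have "card (inversions N (u \<circ> v) - inversions N v) = card (inversions N u)"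
    by (rule bij_betw_same_card)
  then show ?thesis
    using sub by (simp add: inv_count_def card_Diff_subset)
      (metis add.commute card_mono finite_inversions le_add_diff_inverse2)
qed

text \<open>The end points give both bounds: \<open>1 \<le> v 1\<close> propagates upwards to
  \<open>i \<le> v i\<close>, and \<open>v N \<le> N\<close> propagates downwards to
  \<open>v i \<le> i\<close>.\<close>

lemma increasing_permutation_eq_id:
  assumes v: "v permutes {1..N::nat}"
    and asc: "\<And>i. 1 \<le> i \<Longrightarrow> i < N \<Longrightarrow> v i < v (i + 1)"
  shows "v = id"
proof -
  have ge: "i \<le> N \<longrightarrow> i \<le> v i" if "1 \<le> i" for i
    using that
  proof (induction rule: dec_induct)
    case base
    then show ?case using permutes_in_image[OF v, of 1] by auto
  next
    case (step i)
    then show ?case using asc[of i] by auto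
  qed
  have le: "1 \<le> i \<longrightarrow> v i \<le> i" if "i \<le> N" for i
    using that
  proof (induction rule: inc_induct)
    case base
    then show ?case using permutes_in_image[OF v, of N] by auto
  next
    case (step i)
    then show ?case using asc[of i] by auto
  qed
  show ?thesis
  proof
    fix x show "v x = id x"
    proof (cases "x \<in> {1..N}")
      case True then show ?thesis using ge[of x] le[of x] by auto
    next
      case False then show ?thesis using permutes_not_in[OF v] by simp
    qed
  qed
qed

text \<open>Equal inversions make \<open>u \<circ> inv' v\<close> increasing on
  \<open>{1..N}\<close>, hence the identity. Longest elements are identified in this way.\<close>

lemma permutes_eqI_inversions:
  assumes u: "u permutes {1..N::nat}" and v: "v permutes {1..N}"
    and eq: "\<And>x y. 1 \<le> x \<Longrightarrow> x < y \<Longrightarrow> y \<le> N \<Longrightarrow> u y < u x \<longleftrightarrow> v y < v x"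
  shows "u = v"
proof -
  have eq': "u x < u y \<longleftrightarrow> v x < v y" if xy: "x \<in> {1..N}" "y \<in> {1..N}" for x y
  proof -
    have ne: "u x \<noteq> u y" "v x \<noteq> v y" if "x \<noteq> y"
      using that permutes_inj[OF u] permutes_inj[OF v] by (auto simp: inj_eq)
    consider "x < y" | "x = y" | "y < x" by linarith
    then show ?thesis
    proof cases
      case 1 then show ?thesis using eq[of x y] xy ne by auto
    next
      case 3 then show ?thesis using eq[of y x] xy ne by auto
    qed simp
  qed
  have "u \<circ> inv' v = id"
  proof (rule increasing_permutation_eq_id)
    show "u \<circ> inv' v permutes {1..N}"
      by (intro permutes_compose permutes_inv u v)
    fix i assume i: "1 \<le> i" "i < N"
    have "inv' v i \<in> {1..N}" "inv' v (i + 1) \<in> {1..N}"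
      using i permutes_in_image[OF permutes_inv[OF v]] by auto
    then have "u (inv' v i) < u (inv' v (i + 1))"
      using eq' permutes_inverses(1)[OF v] by simp
    then show "(u \<circ> inv' v) i < (u \<circ> inv' v) (i + 1)" by simp
  qed
  then show ?thesis
    using permutes_inv_o(2)[OF v] by (metis comp_assoc comp_id id_comp)
qed

section \<open>Simple reflections and left descents\<close>

lemma simple_refl_permutes: "i \<in> {1..N - 1} \<Longrightarrow> simple_refl i permutes {1..N}"
  unfolding simple_refl_def by (rule permutes_swap_id) auto

lemma simple_refl_apply:
  "simple_refl i x = (if x = i then i + 1 else if x = i + 1 then i else x)"
  by (auto simp: simple_refl_def transpose_def)

lemma simple_refl_invol [simp]: "simple_refl i (simple_refl i x) = x"
  by (simp add: simple_refl_def)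

lemma simple_refl_comp_invol [simp]: "simple_refl i \<circ> (simple_refl i \<circ> w) = w"
  by (simp add: fun_eq_iff)

lemma inv_count_simple_refl: "i \<in> {1..N - 1} \<Longrightarrow> inv_count N (simple_refl i) = 1"
proof -
  assume "i \<in> {1..N - 1}"
  then have "inversions N (simple_refl i) = {(i, i + 1)}"
    by (auto simp: inversions_def simple_refl_apply split: if_splits)
  then show ?thesis by (simp add: inv_count_def)
qed

text \<open>Only the values \<open>i\<close> and \<open>i + 1\<close> change their relative order.
  They occur in increasing order in \<open>w\<close>, so no inversion of \<open>w\<close> is
  lost.\<close>

lemma inv_count_simple_refl_left_ascent:
  assumes w: "w permutes {1..N}" and i: "i \<in> {1..N - 1}" and asc: "inv' w i < inv' w (i + 1)"
  shows "inv_count N (simple_refl i \<circ> w) = inv_count N w + 1"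
proof -
  have "len_add N (simple_refl i) w"
  proof -
    have "simple_refl i (w y) < simple_refl i (w x)"
      if "x < y" "w y < w x" for x y
    proof -
      have "\<not> (w x = i + 1 \<and> w y = i)"
        using that asc permutes_inverses(2)[OF w] by (metis less_asym)
      then show ?thesis using that by (auto simp: simple_refl_apply)
    qed
    then show ?thesis by (auto simp: len_add_def)
  qed
  then show ?thesis
    using inv_count_comp[OF simple_refl_permutes[OF i] w] inv_count_simple_refl[OF i] by simp
qed

lemma inv_simple_refl_comp:
  assumes w: "w permutes {1..N}"
  shows "inv' (simple_refl i \<circ> w) = inv' w \<circ> simple_refl i"
proof (rule inv_unique_comp)
  show "simple_refl i \<circ> w \<circ> (inv' w \<circ> simple_refl i) = id"
    using permutes_inverses(1)[OF w] by (simp add: fun_eq_iff)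
  show "inv' w \<circ> simple_refl i \<circ> (simple_refl i \<circ> w) = id"
    using permutes_inverses(2)[OF w] by (simp add: fun_eq_iff)
qed

lemma inv_count_simple_refl_left_descent:
  assumes w: "w permutes {1..N}" and i: "i \<in> {1..N - 1}" and desc: "inv' w (i + 1) < inv' w i"
  shows "inv_count N w = inv_count N (simple_refl i \<circ> w) + 1"
proof -
  have "inv_count N (simple_refl i \<circ> (simple_refl i \<circ> w)) = inv_count N (simple_refl i \<circ> w) + 1"
  proof (rule inv_count_simple_refl_left_ascent)
    show "simple_refl i \<circ> w permutes {1..N}"
      by (intro permutes_compose w simple_refl_permutes i)
    show "inv' (simple_refl i \<circ> w) i < inv' (simple_refl i \<circ> w) (i + 1)"
      using desc by (simp add: inv_simple_refl_comp[OF w] simple_refl_apply)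
  qed (rule i)
  then show ?thesis by simp
qed

lemma inv_neq: "w permutes S \<Longrightarrow> inv' w i = inv' w j \<longleftrightarrow> i = j"
  by (metis permutes_inverses(1))

lemma left_descent_iff:
  assumes w: "w permutes {1..N}" and i: "i \<in> {1..N - 1}"
  shows "inv' w (i + 1) < inv' w i \<longleftrightarrow> inv_count N (simple_refl i \<circ> w) < inv_count N w"
  using inv_count_simple_refl_left_ascent[OF w i] inv_count_simple_refl_left_descent[OF w i]
    inv_neq[OF w, of i "i + 1"] by (cases "inv' w i < inv' w (i + 1)") auto

lemma inv_count_simple_refl_le:
  assumes w: "w permutes {1..N}" and i: "i \<in> {1..N - 1}"
  shows "inv_count N (simple_refl i \<circ> w) \<le> inv_count N w + 1"
  using inv_count_simple_refl_left_ascent[OF w i] inv_count_simple_refl_left_descent[OF w i]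
    inv_neq[OF w, of i "i + 1"] by (cases "inv' w i < inv' w (i + 1)") auto

section \<open>Words in the simple generators and reduced expressions\<close>

lemma perm_of_word_Nil [simp]: "perm_of_word N [] = id"
  by (simp add: perm_of_word_def sym_group_def)

lemma perm_of_word_Cons [simp]: "perm_of_word N (i # u) = simple_refl i \<circ> perm_of_word N u"
  by (simp add: perm_of_word_def sym_group_def)

lemma perm_of_word_append: "perm_of_word N (u @ v) = perm_of_word N u \<circ> perm_of_word N v"
  by (induction u) (simp_all add: comp_assoc)

lemma perm_of_word_permutes:
  "u \<in> lists {1..N - 1} \<Longrightarrow> perm_of_word N u permutes {1..N}"
proof (induction rule: lists.induct)
  case Nil then show ?case by (simp only: perm_of_word_Nil permutes_id)
next
  case (Cons i u)
  then show ?case by (simp only: perm_of_word_Cons) (intro permutes_compose simple_refl_permutes)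
qed

lemma inv_count_perm_of_word_le:
  "u \<in> lists {1..N - 1} \<Longrightarrow> inv_count N (perm_of_word N u) \<le> length u"
proof (induction rule: lists.induct)
  case Nil
  then show ?case by simp
next
  case (Cons i u)
  then show ?case
    using inv_count_simple_refl_le[OF perm_of_word_permutes[of u N] Cons.hyps(1)] by (simp add: comp_def)
qed

text \<open>Stripping a left descent lowers the inversion count by one. Without left descents the
  inverse is increasing, so the identity has been reached.\<close>

lemma exists_word:
  assumes "w permutes {1..N}"
  shows "\<exists>u \<in> lists {1..N - 1}. perm_of_word N u = w \<and> length u = inv_count N w"
  using assms
proof (induction "inv_count N w" arbitrary: w rule: less_induct)
  case less
  show ?case
  proof (cases "\<exists>i \<in> {1..N - 1}. inv' w (i + 1) < inv' w i")
    case True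
    then obtain i where i: "i \<in> {1..N - 1}" and desc: "inv' w (i + 1) < inv' w i" by blast
    let ?w = "simple_refl i \<circ> w"
    have c: "inv_count N w = inv_count N ?w + 1"
      by (rule inv_count_simple_refl_left_descent[OF less.prems i desc])
    have "?w permutes {1..N}" by (intro permutes_compose less.prems simple_refl_permutes i)
    then obtain u where "u \<in> lists {1..N - 1}" "perm_of_word N u = ?w" "length u = inv_count N ?w"
      using less.hyps c by fastforce
    then show ?thesis using i c by (intro bexI[of _ "i # u"]) auto
  next
    case False
    have "inv' w = id"
    proof (rule increasing_permutation_eq_id)
      show "inv' w permutes {1..N}" by (rule permutes_inv[OF less.prems])
      fix i assume "1 \<le> i" "i < N"
      then show "inv' w i < inv' w (i + 1)"
        using False inv_neq[OF less.prems, of i "i + 1"] by force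
    qed
    then have "w = id" using less.prems by (metis inv_id permutes_inv_inv)
    then show ?thesis by (intro bexI[of _ "[]"]) auto
  qed
qed

text \<open>Each letter raises the inversion count by at most one, so the count bounds word lengths
  from below; \<open>exists_word\<close> attains the bound.\<close>

lemma cox_length_eq_inv_count:
  assumes "w permutes {1..N}"
  shows "cox_length N w = inv_count N w"
  unfolding cox_length_def
proof (rule Least_equality)
  show "\<exists>u \<in> lists {1..N - 1}. length u = inv_count N w \<and> perm_of_word N u = w"
    using exists_word[OF assms] by blast
  show "inv_count N w \<le> r" if "\<exists>u \<in> lists {1..N - 1}. length u = r \<and> perm_of_word N u = w" for r
    using that inv_count_perm_of_word_le by blast
qed

lemma reduced_expr_iff:
  assumes "w permutes {1..N}"
  shows "reduced_expr N w u \<longleftrightarrow>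
    u \<in> lists {1..N - 1} \<and> perm_of_word N u = w \<and> length u = inv_count N w"
  by (simp add: reduced_expr_def cox_length_eq_inv_count[OF assms])

lemma reduced_expr_exists: "w permutes {1..N} \<Longrightarrow> \<exists>u. reduced_expr N w u"
  using exists_word reduced_expr_iff by blast

lemma reduced_expr_permutes: "reduced_expr N w u \<Longrightarrow> w permutes {1..N}"
  using perm_of_word_permutes by (auto simp: reduced_expr_def)

lemma reduced_expr_lists: "reduced_expr N w u \<Longrightarrow> u \<in> lists {1..N - 1}"
  by (simp add: reduced_expr_def)

text \<open>If \<open>i\<close> were not a left descent, the tail would be too short for a
  permutation with more inversions than \<open>w\<close>. This drives the induction for Matsumoto's
  theorem.\<close>

lemma reduced_expr_Cons_iff:
  assumes w: "w permutes {1..N}" and i: "i \<in> {1..N - 1}"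
  shows "reduced_expr N w (i # u) \<longleftrightarrow>
    inv' w (i + 1) < inv' w i \<and> reduced_expr N (simple_refl i \<circ> w) u"
proof
  have sw: "simple_refl i \<circ> w permutes {1..N}"
    by (intro permutes_compose w simple_refl_permutes i)
  {
    assume "reduced_expr N w (i # u)"
    then have u: "u \<in> lists {1..N - 1}" and pu: "perm_of_word N u = simple_refl i \<circ> w"
      and len: "Suc (length u) = inv_count N w"
      using reduced_expr_iff[OF w] by auto
    have "inv_count N (simple_refl i \<circ> w) \<le> length u"
      using inv_count_perm_of_word_le[OF u] pu by simp
    moreover from this have "inv' w (i + 1) < inv' w i"
      using left_descent_iff[OF w i] len by simp
    moreover have "inv_count N w = inv_count N (simple_refl i \<circ> w) + 1"
      using calculation(2) by (rule inv_count_simple_refl_left_descent[OF w i])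
    ultimately show "inv' w (i + 1) < inv' w i \<and> reduced_expr N (simple_refl i \<circ> w) u"
      using u pu len reduced_expr_iff[OF sw] by auto
  next
    assume "inv' w (i + 1) < inv' w i \<and> reduced_expr N (simple_refl i \<circ> w) u"
    then show "reduced_expr N w (i # u)"
      using i reduced_expr_iff[OF w] reduced_expr_iff[OF sw]
        inv_count_simple_refl_left_descent[OF w i] by auto
  }
qed

text \<open>Matsumoto's theorem for the symmetric group: two left descents of \<open>w\<close> are both
  completed to the longest element of the rank-two parabolic subgroup they generate.\<close>

lemma reduced_exprs_congruent:
  assumes "reduced_expr N w u" "reduced_expr N w v"
  shows "(u, v) \<in> pres_cong {1..N - 1} (braid_rels N)"
  using assms
proof (induction "length u" arbitrary: u v w rule: less_induct)
  case less
  let ?C = "pres_cong {1..N - 1} (braid_rels N)"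
  have w: "w permutes {1..N}" using less.prems(1) by (rule reduced_expr_permutes)
  have len: "length u = length v" using less.prems by (simp add: reduced_expr_def)
  have lists: "u \<in> lists {1..N - 1}" "v \<in> lists {1..N - 1}"
    using less.prems by (auto simp: reduced_expr_def)
  show ?case
  proof (cases u)
    case Nil
    then show ?thesis using len by (simp add: pres_cong.refl)
  next
    case (Cons i u')
    then obtain j v' where v: "v = j # v'" using len by (cases v) auto
    note u = Cons
    have i: "i \<in> {1..N - 1}" and j: "j \<in> {1..N - 1}" using lists u v by auto
    have di: "inv' w (i + 1) < inv' w i" and ru: "reduced_expr N (simple_refl i \<circ> w) u'"
      using less.prems(1) reduced_expr_Cons_iff[OF w i] u by auto
    have dj: "inv' w (j + 1) < inv' w j" and rv: "reduced_expr N (simple_refl j \<circ> w) v'"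
      using less.prems(2) reduced_expr_Cons_iff[OF w j] v by auto
    have si: "simple_refl i \<circ> w permutes {1..N}" and sj: "simple_refl j \<circ> w permutes {1..N}"
      by (intro permutes_compose w simple_refl_permutes i j)+
    have sij: "simple_refl i \<circ> (simple_refl j \<circ> w) permutes {1..N}"
      and sji: "simple_refl j \<circ> (simple_refl i \<circ> w) permutes {1..N}"
      by (intro permutes_compose si sj simple_refl_permutes i j)+
    have extend: "(k # x, k # y) \<in> ?C" if "(x, y) \<in> ?C" "k \<in> {1..N - 1}" for k x y
      using pres_cong_append_left[OF that(1), of "[k]"] that(2) by simp
    have lu: "length u' < length u" and lv: "length v' < length u" using u v len by auto
    \<comment> \<open>By induction each tail may be exchanged for another reduced word of the same
      permutation. Suitable tails leave a single defining relation to apply.\<close>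
    have finish: "(u, v) \<in> ?C"
      if "reduced_expr N (simple_refl i \<circ> w) x" "reduced_expr N (simple_refl j \<circ> w) y"
        "(i # x, j # y) \<in> ?C" for x y
    proof -
      have "(i # u', i # x) \<in> ?C" using less.hyps[OF lu ru that(1)] i by (rule extend)
      moreover have "(j # y, j # v') \<in> ?C"
        using less.hyps[OF lv rv that(2)] j by (intro extend) (rule pres_cong.sym)
      ultimately show ?thesis using u v that(3) by (meson pres_cong.trans)
    qed
    consider "i = j" | "\<bar>int i - int j\<bar> > 1" | "\<bar>int i - int j\<bar> = 1" by linarith
    then show ?thesis
    proof cases
      case 1
      then have "(u', v') \<in> ?C" using less.hyps[OF lu ru] rv by simp
      then show ?thesis using extend u v i 1 by simp
    next
      case 2
      have comm: "simple_refl i \<circ> (simple_refl j \<circ> w) = simple_refl j \<circ> (simple_refl i \<circ> w)"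
        using 2 by (auto simp: fun_eq_iff simple_refl_apply)
      \<comment> \<open>With both descents removed, a common tail \<open>x\<close> serves both
        words.\<close>
      obtain x where x: "reduced_expr N (simple_refl i \<circ> (simple_refl j \<circ> w)) x"
        using reduced_expr_exists[OF sij] by blast
      have "inv' (simple_refl i \<circ> w) (j + 1) < inv' (simple_refl i \<circ> w) j"
        using dj 2 by (auto simp: inv_simple_refl_comp[OF w] simple_refl_apply)
      then have rx1: "reduced_expr N (simple_refl i \<circ> w) (j # x)"
        using reduced_expr_Cons_iff[OF si j] x comm by simp
      have "inv' (simple_refl j \<circ> w) (i + 1) < inv' (simple_refl j \<circ> w) i"
        using di 2 by (auto simp: inv_simple_refl_comp[OF w] simple_refl_apply)
      then have rx2: "reduced_expr N (simple_refl j \<circ> w) (i # x)"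
        using reduced_expr_Cons_iff[OF sj i] x by simp
      have "([] @ [i, j] @ x, [] @ [j, i] @ x) \<in> ?C"
        using i j 2 x by (intro pres_cong.rel) (auto simp: braid_rels_def reduced_expr_def)
      then show ?thesis using finish[OF rx1 rx2] by simp
    next
      case 3
      then have ij: "j = i + 1 \<or> i = j + 1" by linarith
      have braid: "simple_refl i \<circ> (simple_refl j \<circ> (simple_refl i \<circ> w))
          = simple_refl j \<circ> (simple_refl i \<circ> (simple_refl j \<circ> w))"
        using ij by (auto simp: fun_eq_iff simple_refl_apply)
      \<comment> \<open>The tail \<open>x\<close> is to represent \<open>w\<close> stripped of the
        longest element generated by \<open>i\<close> and \<open>j\<close>. All descent checks below
        follow because \<open>inv' w\<close> decreases along three consecutive points.\<close>
      have "simple_refl i \<circ> (simple_refl j \<circ> (simple_refl i \<circ> w)) permutes {1..N}"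
        by (intro permutes_compose sji simple_refl_permutes i)
      then obtain x where x: "reduced_expr N (simple_refl i \<circ> (simple_refl j \<circ> (simple_refl i \<circ> w))) x"
        using reduced_expr_exists by blast
      have "inv' (simple_refl j \<circ> (simple_refl i \<circ> w)) (i + 1)
          < inv' (simple_refl j \<circ> (simple_refl i \<circ> w)) i"
        using ij di dj
        by (auto simp: inv_simple_refl_comp[OF si] inv_simple_refl_comp[OF w] simple_refl_apply)
      then have "reduced_expr N (simple_refl j \<circ> (simple_refl i \<circ> w)) (i # x)"
        using reduced_expr_Cons_iff[OF sji i] x by simp
      moreover have "inv' (simple_refl i \<circ> w) (j + 1) < inv' (simple_refl i \<circ> w) j"
        using ij di dj by (auto simp: inv_simple_refl_comp[OF w] simple_refl_apply)
      ultimately have rx1: "reduced_expr N (simple_refl i \<circ> w) (j # i # x)"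
        using reduced_expr_Cons_iff[OF si j] by simp
      have "inv' (simple_refl i \<circ> (simple_refl j \<circ> w)) (j + 1)
          < inv' (simple_refl i \<circ> (simple_refl j \<circ> w)) j"
        using ij di dj
        by (auto simp: inv_simple_refl_comp[OF sj] inv_simple_refl_comp[OF w] simple_refl_apply)
      then have "reduced_expr N (simple_refl i \<circ> (simple_refl j \<circ> w)) (j # x)"
        using reduced_expr_Cons_iff[OF sij j] x braid by simp
      moreover have "inv' (simple_refl j \<circ> w) (i + 1) < inv' (simple_refl j \<circ> w) i"
        using ij di dj by (auto simp: inv_simple_refl_comp[OF w] simple_refl_apply)
      ultimately have rx2: "reduced_expr N (simple_refl j \<circ> w) (i # j # x)"
        using reduced_expr_Cons_iff[OF sj i] by simp
      have "([] @ [i, j, i] @ x, [] @ [j, i, j] @ x) \<in> ?C"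
        using i j 3 x by (intro pres_cong.rel) (auto simp: braid_rels_def reduced_expr_def)
      then show ?thesis using finish[OF rx1 rx2] by simp
    qed
  qed
qed

section \<open>Lifts of permutations to the braid monoid\<close>

lemma T_lift_eq_word_class:
  assumes "reduced_expr N w u"
  shows "T_lift N w = word_class {1..N - 1} (braid_rels N) u"
proof -
  have some: "reduced_expr N w (SOME u. reduced_expr N w u)" using assms by (rule someI)
  show ?thesis
    unfolding T_lift_def
    using word_class_eq_iff[OF reduced_expr_lists[OF some] reduced_expr_lists[OF assms]]
      reduced_exprs_congruent[OF some assms] by blast
qed

lemma T_lift_in_carrier:
  assumes "w permutes {1..N}"
  shows "T_lift N w \<in> carrier (Br N)"
proof -
  obtain u where "reduced_expr N w u" using reduced_expr_exists[OF assms] by blast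
  then show ?thesis
    unfolding T_lift_eq_word_class[OF \<open>reduced_expr N w u\<close>] Br_def carrier_presented_monoid
    by (auto simp: reduced_expr_def)
qed

text \<open>Since inversion counts add, concatenating reduced expressions gives a reduced expression
  of the product.\<close>

lemma T_lift_comp:
  assumes u: "u permutes {1..N}" and v: "v permutes {1..N}" and "len_add N u v"
  shows "T_lift N u \<otimes>\<^bsub>Br N\<^esub> T_lift N v = T_lift N (u \<circ> v)"
proof -
  obtain x where x: "reduced_expr N u x" using reduced_expr_exists[OF u] by blast
  obtain y where y: "reduced_expr N v y" using reduced_expr_exists[OF v] by blast
  have uv: "u \<circ> v permutes {1..N}" by (intro permutes_compose u v)
  have xy: "x \<in> lists {1..N - 1}" "y \<in> lists {1..N - 1}"
    using x y by (auto simp: reduced_expr_def)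
  have "reduced_expr N (u \<circ> v) (x @ y)"
    using x y inv_count_comp[OF assms] unfolding reduced_expr_iff[OF u] reduced_expr_iff[OF v]
      reduced_expr_iff[OF uv] perm_of_word_append by simp
  then show ?thesis
    unfolding T_lift_eq_word_class[OF x] T_lift_eq_word_class[OF y] Br_def
      mult_presented_monoid[OF xy] by (rule T_lift_eq_word_class[symmetric])
qed

section \<open>Longest elements of parabolic subgroups\<close>

text \<open>The points \<open>l, \<dots>, h\<close> form the orbit of \<open>x\<close> under the parabolic subgroup of \<open>L\<close>. The
  truncated \<open>l - 1\<close> is harmless because \<open>0\<close> is never in \<open>L\<close>.\<close>

definition is_block :: "nat set \<Rightarrow> nat \<Rightarrow> nat \<Rightarrow> nat \<Rightarrow> bool" where
  "is_block L x l h \<longleftrightarrow> l \<le> x \<and> x \<le> h \<and> {l..<h} \<subseteq> L \<and> l - 1 \<notin> L \<and> h \<notin> L"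

definition block_rev :: "nat set \<Rightarrow> nat \<Rightarrow> nat" where
  "block_rev L x = (THE y. \<exists>l h. is_block L x l h \<and> y = l + h - x)"

text \<open>If one block reached further on either side, its generators would include the boundary
  element \<open>l - 1\<close> or \<open>h\<close> that the other block excludes.\<close>

lemma is_block_unique:
  assumes "is_block L x l h" "is_block L x l' h'"
  shows "l = l' \<and> h = h'"
proof -
  have aux: "l \<le> l' \<and> h \<le> h'" if a: "is_block L x l h" and b: "is_block L x l' h'" for l h l' h'
  proof (intro conjI leI notI)
    assume "l' < l"
    then have "l - 1 \<in> {l'..<h'}" using a b unfolding is_block_def atLeastLessThan_iff by linarith
    then show False using a b unfolding is_block_def by blast
  next
    assume "h' < h"
    then have "h' \<in> {l..<h}" using a b unfolding is_block_def atLeastLessThan_iff by linarith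
    then show False using a b unfolding is_block_def by blast
  qed
  show ?thesis using aux[OF assms] aux[OF assms(2,1)] by simp
qed

lemma is_block_exists:
  assumes "finite L" "0 \<notin> L"
  obtains l h where "is_block L x l h"
proof -
  have "\<not> {x..} \<subseteq> L"
    using assms(1) infinite_Ici finite_subset by blast
  then have "\<exists>h. x \<le> h \<and> h \<notin> L" by auto
  define h where "h = (LEAST h. x \<le> h \<and> h \<notin> L)"
  have h: "x \<le> h \<and> h \<notin> L"
    unfolding h_def by (rule LeastI_ex) fact
  have hs: "{x..<h} \<subseteq> L"
    using not_less_Least[of _ "\<lambda>h. x \<le> h \<and> h \<notin> L"] unfolding h_def[symmetric] by auto
  define l where "l = (LEAST l. l \<le> x \<and> {l..<x} \<subseteq> L)"
  have l: "l \<le> x \<and> {l..<x} \<subseteq> L"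
    unfolding l_def by (rule LeastI[of _ x]) simp
  have "l - 1 \<notin> L"
  proof
    assume a: "l - 1 \<in> L"
    \<comment> \<open>As \<open>0 \<notin> L\<close>, the truncated difference \<open>l - 1\<close>
      is nonzero, so extending the interval to the left does contradict the minimality of
      \<open>l\<close>.\<close>
    then have "l > 1" using assms(2) by (cases "l - 1 = 0") auto
    have "{l - 1..<x} \<subseteq> insert (l - 1) {l..<x}" using \<open>l > 1\<close> by auto
    then have "l - 1 \<le> x \<and> {l - 1..<x} \<subseteq> L" using a l by auto
    then have "l \<le> l - 1" unfolding l_def by (rule Least_le)
    then show False using \<open>l > 1\<close> by simp
  qed
  moreover have "{l..<h} = {l..<x} \<union> {x..<h}" using l h by auto
  ultimately have "is_block L x l h" using l h hs by (simp add: is_block_def)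
  then show ?thesis by (rule that)
qed

lemma block_rev_eq:
  assumes "is_block L x l h"
  shows "block_rev L x = l + h - x"
  unfolding block_rev_def using assms by (blast intro: the_equality dest: is_block_unique)

lemma is_block_reflect: "is_block L x l h \<Longrightarrow> is_block L (l + h - x) l h"
  by (auto simp: is_block_def)

locale generator_set =
  fixes N :: nat and L :: "nat set"
  assumes subset: "L \<subseteq> {1..N - 1}"
begin

lemma finite: "finite L"
  using subset finite_subset by blast

lemma zero_notin: "0 \<notin> L"
  using subset by auto

lemma obtain_block:
  obtains l h where "is_block L x l h" "block_rev L x = l + h - x" "l \<le> x" "x \<le> h"
proof -
  obtain l h where *: "is_block L x l h" using is_block_exists finite zero_notin by metis
  show ?thesis using * by (intro that[OF * block_rev_eq[OF *]]) (auto simp: is_block_def)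
qed

lemma block_rev_invol [simp]: "block_rev L (block_rev L x) = x"
proof -
  obtain l h where b: "is_block L x l h" "block_rev L x = l + h - x" "l \<le> x" "x \<le> h"
    by (rule obtain_block)
  then show ?thesis using block_rev_eq[OF is_block_reflect[OF b(1)]] by simp
qed

lemma block_rev_fixed: "x \<notin> L \<Longrightarrow> x - 1 \<notin> L \<Longrightarrow> block_rev L x = x"
  using block_rev_eq[of L x x x] by (simp add: is_block_def)

lemma block_rev_permutes: "block_rev L permutes {1..N}"
  unfolding permutes_def
proof (intro conjI allI impI)
  fix x assume "x \<notin> {1..N}"
  then have "x \<notin> {1..N - 1}" "x - 1 \<notin> {1..N - 1}" by auto
  then show "block_rev L x = x" using subset by (intro block_rev_fixed) blast+
next
  fix y show "\<exists>!x. block_rev L x = y" by (metis block_rev_invol)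
qed

text \<open>Blocks are disjoint intervals, each mapped to itself in reverse. Exactly the pairs
  within one block are inverted, and being in one block means that no generator in between is
  missing.\<close>

lemma block_rev_less_iff:
  assumes "x < y"
  shows "block_rev L y < block_rev L x \<longleftrightarrow> {x..<y} \<subseteq> L"
proof -
  obtain l h where b: "is_block L x l h" "block_rev L x = l + h - x" "l \<le> x" "x \<le> h"
    by (rule obtain_block)
  obtain l' h' where b': "is_block L y l' h'" "block_rev L y = l' + h' - y" "l' \<le> y" "y \<le> h'"
    by (rule obtain_block)
  show ?thesis
  proof
    assume s: "{x..<y} \<subseteq> L"
    have "y \<le> h"
    proof (rule ccontr)
      assume "\<not> y \<le> h"
      then have "h \<in> {x..<y}" using b by auto
      then show False using s b by (auto simp: is_block_def)
    qed
    then have "is_block L y l h" using b assms by (auto simp: is_block_def)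
    then show "block_rev L y < block_rev L x"
      using block_rev_eq b \<open>y \<le> h\<close> assms by auto
  next
    assume less: "block_rev L y < block_rev L x"
    show "{x..<y} \<subseteq> L"
    proof
      fix z assume z: "z \<in> {x..<y}"
      show "z \<in> L"
      proof (rule ccontr)
        assume "z \<notin> L"
        then have "z \<notin> {l..<h}" "z \<notin> {l'..<h'}"
          using b(1) b'(1) unfolding is_block_def by blast+
        \<comment> \<open>A missing generator separates the blocks: \<open>h \<le> z\<close> and
          \<open>z < l'\<close>, and reversal keeps each block in place.\<close>
        then have "\<not> z < h" "\<not> l' \<le> z"
          using z b b' by simp_all
        then show False using less b b' by auto
      qed
    qed
  qed
qed

lemma eq_block_revI:
  assumes "w permutes {1..N}"
    and "\<And>x y. 1 \<le> x \<Longrightarrow> x < y \<Longrightarrow> y \<le> N \<Longrightarrow> w y < w x \<longleftrightarrow> {x..<y} \<subseteq> L"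
  shows "w = block_rev L"
  using assms block_rev_permutes block_rev_less_iff by (intro permutes_eqI_inversions) auto

section \<open>Identification of the longest element\<close>

lemma parabolic_permutes:
  assumes "w \<in> parabolic N L"
  shows "w permutes {1..N}"
proof -
  interpret group "sym_group N" by (rule sym_group_is_group)
  have "simple_refl ` L \<subseteq> carrier (sym_group N)"
    using subset simple_refl_permutes by (auto simp: sym_group_carrier)
  then show ?thesis
    using generate_in_carrier assms sym_group_carrier unfolding parabolic_def by blast
qed

text \<open>Only \<open>simple_refl z\<close> moves points across the cut between \<open>z\<close>
  and \<open>z + 1\<close>. The other simple reflections respect the cut, and so do their
  products.\<close>

lemma parabolic_preserves_initial:
  assumes "w \<in> parabolic N L" "z \<notin> L"
  shows "w x \<le> z \<longleftrightarrow> x \<le> z"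
proof -
  interpret group "sym_group N" by (rule sym_group_is_group)
  have s: "simple_refl i x \<le> z \<longleftrightarrow> x \<le> z" if "i \<in> L" for i x
  proof -
    have "i \<noteq> z" using that assms(2) by auto
    then show ?thesis by (auto simp: simple_refl_apply)
  qed
  show ?thesis
    using assms(1) unfolding parabolic_def
  proof (induction arbitrary: x rule: generate.induct)
    case one
    then show ?case by (simp add: sym_group_def)
  next
    case (incl g)
    then show ?case using s by auto
  next
    case (inv g)
    then obtain i where i: "i \<in> L" "g = simple_refl i" by auto
    then have "g \<in> carrier (sym_group N)"
      using subset simple_refl_permutes by (auto simp: sym_group_carrier)
    moreover have "g \<otimes>\<^bsub>sym_group N\<^esub> g = \<one>\<^bsub>sym_group N\<^esub>"
      using i by (simp add: sym_group_def fun_eq_iff)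
    ultimately have "inv\<^bsub>sym_group N\<^esub> g = g" by (intro inv_equality)
    then show ?case using s i by (simp only:)
  next
    case (eng g g')
    then show ?case by (simp add: sym_group_def)
  qed
qed

text \<open>Whichever maximizer is picked, its inversions are forced: maximality makes every
  \<open>i \<in> L\<close> a right descent, so values decrease along intervals of generators, and a
  missing generator prevents an inversion.\<close>

lemma longest_elt_eq: "longest_elt N L = block_rev L"
proof (rule eq_block_revI)
  let ?P = "\<lambda>w. w \<in> parabolic N L" and ?w = "longest_elt N L"
  have id: "?P id" using generate.one[of "sym_group N"] by (simp add: parabolic_def sym_group_def)
  \<comment> \<open>The maximum exists because lengths are bounded by the number of pairs.\<close>
  have "cox_length N w < Suc (card ({1..N} \<times> {1..N}))" if "?P w" for w
  proof -
    have "inversions N w \<subseteq> {1..N} \<times> {1..N}" by (auto simp: inversions_def)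
    then have "inv_count N w \<le> card ({1..N} \<times> {1..N})"
      unfolding inv_count_def by (intro card_mono) auto
    then show ?thesis using cox_length_eq_inv_count[OF parabolic_permutes[OF that]] by simp
  qed
  then have max: "?P ?w \<and> (\<forall>v. ?P v \<longrightarrow> cox_length N v \<le> cox_length N ?w)"
    unfolding longest_elt_def using id by (intro arg_max_nat_lemma) blast+
  then have w: "?P ?w" by blast
  show perm: "?w permutes {1..N}" by (rule parabolic_permutes[OF w])
  have desc: "?w (i + 1) < ?w i" if "i \<in> L" for i
  proof (rule ccontr)
    assume "\<not> ?w (i + 1) < ?w i"
    then have asc: "?w i < ?w (i + 1)"
      using permutes_inj[OF perm] by (metis add.commute inj_eq linorder_neqE_nat n_not_Suc_n plus_1_eq_Suc)
    have i: "i \<in> {1..N - 1}" using that subset by blast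
    \<comment> \<open>At an ascent, right multiplication by the generator gives a longer element of
      the same subgroup.\<close>
    have "len_add N ?w (simple_refl i)"
      using asc by (auto simp: len_add_def simple_refl_apply)
    then have "inv_count N (?w \<circ> simple_refl i) = inv_count N ?w + 1"
      using inv_count_comp[OF perm simple_refl_permutes[OF i]] inv_count_simple_refl[OF i] by simp
    moreover have P: "?P (?w \<circ> simple_refl i)"
      using w generate.eng[OF _ generate.incl[OF imageI[OF that]]]
      unfolding parabolic_def by (metis sym_group_mult)
    ultimately have "cox_length N ?w < cox_length N (?w \<circ> simple_refl i)"
      using cox_length_eq_inv_count perm parabolic_permutes[OF P] by simp
    then show False using max P by (meson not_less)
  qed
  fix x y :: nat assume xy: "1 \<le> x" "x < y" "y \<le> N"
  show "?w y < ?w x \<longleftrightarrow> {x..<y} \<subseteq> L"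
  proof
    assume less: "?w y < ?w x"
    show "{x..<y} \<subseteq> L"
    proof
      fix z assume z: "z \<in> {x..<y}"
      show "z \<in> L"
      proof (rule ccontr)
        assume "z \<notin> L"
        from parabolic_preserves_initial[OF w this] show False
          using z less by (metis atLeastLessThan_iff leD le_trans less_imp_le_nat)
      qed
    qed
  next
    assume s: "{x..<y} \<subseteq> L"
    have "?w y < ?w x" if "x + 1 \<le> y" "{x..<y} \<subseteq> L" for y
      using that
    proof (induction rule: dec_induct)
      case base then show ?case using desc[of x] by simp
    next
      case (step m)
      then have "{x..<m} \<subseteq> L" "m \<in> L" by auto
      then show ?case using step desc[of m] by (metis Suc_eq_plus1 less_trans)
    qed
    then show "?w y < ?w x" using xy s by simp
  qed
qed

end

section \<open>Half twists and block crossings\<close>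

text \<open>The permutation of the half twist with generators \<open>{c..<d}\<close>. Generator
  \<open>i\<close> moves \<open>i\<close> and \<open>i + 1\<close>, so a half-open set of generators
  corresponds to a closed range of points.\<close>

definition seg_rev :: "nat \<Rightarrow> nat \<Rightarrow> nat \<Rightarrow> nat" where
  "seg_rev c d x = (if c \<le> x \<and> x \<le> d then c + d - x else x)"

lemma block_rev_interval:
  assumes "1 \<le> c" "c \<le> d"
  shows "block_rev {c..<d} = seg_rev c d"
proof
  fix x
  show "block_rev {c..<d} x = seg_rev c d x"
  proof (cases "c \<le> x \<and> x \<le> d")
    case True
    then have "is_block {c..<d} x c d" using assms by (auto simp: is_block_def)
    then show ?thesis using True by (simp add: block_rev_eq seg_rev_def)
  next
    case False
    then have "is_block {c..<d} x x x" using assms by (auto simp: is_block_def)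
    then show ?thesis using False by (auto simp: block_rev_eq seg_rev_def)
  qed
qed

text \<open>For generators this means elementwise distance at least two, stated without truncated
  subtraction. Nontrivial blocks of the two sets are then disjoint.\<close>

definition separated :: "nat set \<Rightarrow> nat set \<Rightarrow> bool" where
  "separated L K \<longleftrightarrow> (\<forall>i\<in>L. \<forall>j\<in>K. i + 1 < j \<or> j + 1 < i)"

lemma separated_sym: "separated L K \<Longrightarrow> separated K L"
  by (auto simp: separated_def)

lemma separatedD:
  assumes "separated L K" "i \<in> L"
  shows "i \<notin> K" "i + 1 \<notin> K" "i - 1 \<notin> K"
  using assms by (force simp: separated_def)+

text \<open>A nontrivial block of the union comes from only one of the sets, and the other
  permutation fixes its points. The case split asks whether \<open>x\<close> is touched by a
  generator in \<open>K\<close>.\<close>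

lemma block_rev_Un:
  assumes "generator_set N L" "generator_set N K" and sep: "separated L K"
  shows "block_rev (L \<union> K) = block_rev L \<circ> block_rev K"
proof
  interpret L: generator_set N L by fact
  interpret K: generator_set N K by fact
  fix x
  show "block_rev (L \<union> K) x = (block_rev L \<circ> block_rev K) x"
  proof (cases "x \<in> K \<or> x - 1 \<in> K")
    case True
    obtain l h where b: "is_block K x l h" "block_rev K x = l + h - x" "l \<le> x" "x \<le> h"
      by (rule K.obtain_block)
    have in_K: "z \<in> K" if "l \<le> z" "z < h" for z
      using that b unfolding is_block_def by auto
    have out_K: "l - 1 \<notin> K" "h \<notin> K"
      using b unfolding is_block_def by blast+
    have "l < h"
    proof (rule ccontr)
      assume "\<not> l < h"
      then have "l = x" "h = x" using b by auto
      then show False using True out_K by auto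
    qed
    then have lh: "l \<in> K" "h - 1 \<in> K" using in_K by auto
    have "l - 1 \<notin> L" "h \<notin> L"
      using separatedD(3)[OF separated_sym[OF sep] lh(1)]
        separatedD(2)[OF separated_sym[OF sep] lh(2)] \<open>l < h\<close> by auto
    then have "is_block (L \<union> K) x l h" using b unfolding is_block_def by blast
    then have "block_rev (L \<union> K) x = l + h - x" by (rule block_rev_eq)
    moreover have "block_rev L (l + h - x) = l + h - x"
    proof (rule L.block_rev_fixed)
      let ?y = "l + h - x"
      have y: "l \<le> ?y" "?y \<le> h" using b by auto
      consider "?y \<in> K" | "?y - 1 \<in> K" "?y \<ge> 1"
        using in_K[of ?y] in_K[of "?y - 1"] y \<open>l < h\<close> by fastforce
      then have "?y \<notin> L \<and> ?y - 1 \<notin> L"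
      proof cases
        case 1 then show ?thesis using separatedD[OF separated_sym[OF sep]] by blast
      next
        case 2
        then show ?thesis
          using separatedD[OF separated_sym[OF sep] 2(1)] le_add_diff_inverse2[OF 2(2)] by simp
      qed
      then show "?y \<notin> L" "?y - 1 \<notin> L" by blast+
    qed
    ultimately show ?thesis using b by simp
  next
    case False
    obtain l h where b: "is_block L x l h" "block_rev L x = l + h - x" "l \<le> x" "x \<le> h"
      by (rule L.obtain_block)
    have "l - 1 \<notin> K \<and> h \<notin> K"
    proof (cases "l < h")
      case True
      then have "l \<in> L" "h - 1 \<in> L" using b unfolding is_block_def by auto
      then show ?thesis
        using separatedD(3)[OF sep, of l] separatedD(2)[OF sep, of "h - 1"] True by auto
    next
      case False
      then have "l = x" "h = x" using b by auto
      then show ?thesis using \<open>\<not> (x \<in> K \<or> x - 1 \<in> K)\<close> by simp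
    qed
    then have "is_block (L \<union> K) x l h" using b unfolding is_block_def by blast
    then show ?thesis using b False K.block_rev_fixed by (simp add: block_rev_eq)
  qed
qed

lemma reflect_subset: "J \<subseteq> {c..<d} \<Longrightarrow> (\<lambda>j. c + d - 1 - j) ` J \<subseteq> {c..<d}" for c d :: nat
  by (rule image_subsetI, drule (1) subsetD) auto

text \<open>The reflection \<open>x \<mapsto> c + d - x\<close> of points carries the pair moved by
  generator \<open>j\<close> to the pair moved by generator \<open>c + d - 1 - j\<close>, and blocks
  of \<open>J\<close> to blocks of the reflected set.\<close>

lemma block_rev_seg_rev_conj:
  assumes cd: "1 \<le> c" "c \<le> d" and J: "J \<subseteq> {c..<d}"
    and "generator_set N J" and "generator_set N ((\<lambda>j. c + d - 1 - j) ` J)"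
  shows "seg_rev c d \<circ> block_rev J = block_rev ((\<lambda>j. c + d - 1 - j) ` J) \<circ> seg_rev c d"
proof
  let ?J = "(\<lambda>j. c + d - 1 - j) ` J"
  interpret J: generator_set N J by fact
  interpret J': generator_set N ?J by fact
  fix x
  show "(seg_rev c d \<circ> block_rev J) x = (block_rev ?J \<circ> seg_rev c d) x"
  proof (cases "c \<le> x \<and> x \<le> d")
    case True
    obtain l h where b: "is_block J x l h" "block_rev J x = l + h - x" "l \<le> x" "x \<le> h"
      by (rule J.obtain_block)
    have in_J: "z \<in> J" if "l \<le> z" "z < h" for z
      using that b unfolding is_block_def by auto
    have out_J: "l - 1 \<notin> J" "h \<notin> J"
      using b unfolding is_block_def by blast+
    have "c \<le> l" using in_J[of l] J b True by (cases "l < h") auto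
    have "h \<le> d" using in_J[of "h - 1"] J b True by (cases "l < h") fastforce+
    have mem: "z \<in> ?J \<longleftrightarrow> c + d - 1 - z \<in> J" if "z \<le> c + d - 1" for z
    proof
      assume "z \<in> ?J"
      then obtain j where "j \<in> J" "z = c + d - 1 - j" by auto
      then show "c + d - 1 - z \<in> J" using J by (auto simp: subset_iff)
    next
      assume "c + d - 1 - z \<in> J"
      then show "z \<in> ?J" using that by (intro image_eqI[of _ _ "c + d - 1 - z"]) auto
    qed
    have "is_block ?J (c + d - x) (c + d - h) (c + d - l)"
      unfolding is_block_def
    proof (intro conjI)
      show "{c + d - h..<c + d - l} \<subseteq> ?J"
      proof
        fix z assume "z \<in> {c + d - h..<c + d - l}"
        then show "z \<in> ?J" using mem[of z] in_J[of "c + d - 1 - z"] \<open>c \<le> l\<close> \<open>h \<le> d\<close> cd by auto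
      qed
      show "c + d - h - 1 \<notin> ?J"
      proof -
        have "c + d - 1 - (c + d - h - 1) = h" using \<open>h \<le> d\<close> cd by simp
        then show ?thesis using mem[of "c + d - h - 1"] out_J by auto
      qed
      show "c + d - l \<notin> ?J"
      proof -
        have "c + d - 1 - (c + d - l) = l - 1" "c + d - l \<le> c + d - 1"
          using \<open>c \<le> l\<close> \<open>h \<le> d\<close> cd b by auto
        then show ?thesis using mem[of "c + d - l"] out_J by auto
      qed
    qed (use b in auto)
    from block_rev_eq[OF this] show ?thesis
      using True b \<open>c \<le> l\<close> \<open>h \<le> d\<close> by (auto simp: seg_rev_def)
  next
    case False
    have out: "x \<notin> {c..<d}" "x - 1 \<notin> {c..<d}" using False cd by auto
    have "?J \<subseteq> {c..<d}" using J by (rule reflect_subset)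
    then have "block_rev ?J x = x" using out by (intro J'.block_rev_fixed) blast+
    moreover have "block_rev J x = x" using out J by (intro J.block_rev_fixed) blast+
    moreover have "seg_rev c d x = x" using False by (auto simp: seg_rev_def)
    ultimately show ?thesis by simp
  qed
qed

text \<open>The shortest permutation exchanging adjacent blocks of \<open>m\<close> and
  \<open>l\<close> points (a Grassmannian permutation); its lift is the positive crossing of the two
  blocks of strands.\<close>

definition seg_cross :: "nat \<Rightarrow> nat \<Rightarrow> nat \<Rightarrow> nat \<Rightarrow> nat" where
  "seg_cross c m l x =
     (if c \<le> x \<and> x < c + m then x + l else if c + m \<le> x \<and> x < c + m + l then x - m else x)"

lemma permutes_if_inverse:
  assumes "\<And>x. x \<notin> S \<Longrightarrow> f x = x" "\<And>x. g (f x) = x" "\<And>x. f (g x) = x"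
  shows "f permutes S"
  unfolding permutes_def using assms by metis

lemma seg_cross_permutes:
  assumes "1 \<le> c" "c + m + l \<le> N + 1"
  shows "seg_cross c m l permutes {1..N}"
proof (rule permutes_if_inverse)
  show "seg_cross c l m (seg_cross c m l x) = x" "seg_cross c m l (seg_cross c l m x) = x" for x
    by (auto simp: seg_cross_def)
  show "seg_cross c m l x = x" if "x \<notin> {1..N}" for x
    using that assms by (auto simp: seg_cross_def)
qed

lemma seg_rev_permutes:
  assumes "1 \<le> c" "d \<le> N"
  shows "seg_rev c d permutes {1..N}"
proof (rule permutes_if_inverse)
  show "seg_rev c d (seg_rev c d x) = x" "seg_rev c d (seg_rev c d x) = x" for x
    by (auto simp: seg_rev_def)
  show "seg_rev c d x = x" if "x \<notin> {1..N}" for x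
    using that assms by (auto simp: seg_rev_def)
qed

text \<open>Left multiplication by \<open>T\<^sub>w\<close>, extended by the identity off the carrier: products become
  compositions of total functions, so that no carrier conditions arise when reassociating.\<close>

definition act :: "nat \<Rightarrow> (nat \<Rightarrow> nat) \<Rightarrow> nat list set \<Rightarrow> nat list set" where
  "act N w y = (if y \<in> carrier (Br N) then T_lift N w \<otimes>\<^bsub>Br N\<^esub> y else y)"

section \<open>Half twists as operators\<close>

lemma monoid_Br: "monoid (Br N)"
  unfolding Br_def by (rule monoid_presented_monoid)

lemma act_comp:
  assumes u: "u permutes {1..N}" and v: "v permutes {1..N}" and "len_add N u v"
  shows "act N u \<circ> act N v = act N (u \<circ> v)"
proof
  interpret monoid "Br N" by (rule monoid_Br)
  fix y
  show "(act N u \<circ> act N v) y = act N (u \<circ> v) y"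
    using T_lift_in_carrier[OF u] T_lift_in_carrier[OF v] T_lift_comp[OF assms]
    by (auto simp: act_def m_assoc[symmetric])
qed

abbreviation act_longest :: "nat \<Rightarrow> nat set \<Rightarrow> nat list set \<Rightarrow> nat list set" where
  "act_longest N L \<equiv> act N (block_rev L)"

text \<open>Lengths add: an inversion of \<open>block_rev K\<close> spans an interval inside
  \<open>K\<close>, hence inside \<open>L \<union> K\<close>, so it is still inverted by the
  composite.\<close>

lemma act_longest_Un:
  assumes L: "generator_set N L" and K: "generator_set N K" and sep: "separated L K"
  shows "act_longest N (L \<union> K) = act_longest N L \<circ> act_longest N K"
proof -
  interpret L: generator_set N L by fact
  interpret K: generator_set N K by fact
  interpret LK: generator_set N "L \<union> K"
    using L.subset K.subset by unfold_locales auto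
  have "len_add N (block_rev L) (block_rev K)"
    unfolding len_add_def
  proof (intro allI impI)
    fix x y assume "x < y" "block_rev K y < block_rev K x"
    then have "{x..<y} \<subseteq> L \<union> K" using K.block_rev_less_iff by auto
    then show "block_rev L (block_rev K y) < block_rev L (block_rev K x)"
      using LK.block_rev_less_iff \<open>x < y\<close> block_rev_Un[OF assms] by simp
  qed
  then show ?thesis
    using act_comp L.block_rev_permutes K.block_rev_permutes block_rev_Un[OF assms] by simp
qed

lemma act_longest_commute:
  assumes "generator_set N L" "generator_set N K" "separated L K"
  shows "act_longest N L \<circ> act_longest N K = act_longest N K \<circ> act_longest N L"
  using act_longest_Un[OF assms] act_longest_Un[OF assms(2,1) separated_sym[OF assms(3)]]
  by (simp add: Un_commute)

text \<open>For \<open>I = {c..<d}\<close> and the reflected set \<open>J'\<close>, the half twist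
  of \<open>I\<close> factors length-additively through one element \<open>m\<close>, as
  \<open>I = mJ\<close> and as \<open>I = J'm\<close>. Hence \<open>IJ = J'mJ = J'I\<close> without
  cancellation.\<close>

lemma act_longest_conj_flip:
  assumes cd: "1 \<le> c" "c \<le> d" "d \<le> N" and J: "J \<subseteq> {c..<d}"
  shows "act_longest N {c..<d} \<circ> act_longest N J
    = act_longest N ((\<lambda>j. c + d - 1 - j) ` J) \<circ> act_longest N {c..<d}"
proof -
  let ?I = "{c..<d}" and ?J = "(\<lambda>j. c + d - 1 - j) ` J"
  have J': "?J \<subseteq> ?I" using J by (rule reflect_subset)
  interpret I: generator_set N ?I using cd by unfold_locales auto
  interpret J: generator_set N J using I.subset J by unfold_locales auto
  interpret J': generator_set N ?J using I.subset J' by unfold_locales blast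
  have conj: "block_rev ?I \<circ> block_rev J = block_rev ?J \<circ> block_rev ?I"
    unfolding block_rev_interval[OF cd(1,2)]
    by (rule block_rev_seg_rev_conj[OF cd(1,2) J J.generator_set_axioms J'.generator_set_axioms])
  \<comment> \<open>As \<open>block_rev J\<close> is an involution, this is
    \<open>block_rev ?I\<close> with \<open>block_rev J\<close> split off on the right, and by
    \<open>conj\<close> also with \<open>block_rev ?J\<close> split off on the left.\<close>
  let ?m = "block_rev ?I \<circ> block_rev J"
  have perm: "?m permutes {1..N}"
    by (intro permutes_compose I.block_rev_permutes J.block_rev_permutes)
  have la1: "len_add N ?m (block_rev J)"
    unfolding len_add_def
  proof (intro allI impI)
    fix x y assume "x < y" "block_rev J y < block_rev J x"
    then have "{x..<y} \<subseteq> ?I" using J.block_rev_less_iff subset_trans[OF _ J] by blast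
    then have "block_rev ?I y < block_rev ?I x" using I.block_rev_less_iff[OF \<open>x < y\<close>] by blast
    then show "?m (block_rev J y) < ?m (block_rev J x)" by simp
  qed
  have la2: "len_add N (block_rev ?J) ?m"
    unfolding len_add_def conj
  proof (intro allI impI)
    fix x y assume "x < y"
      and less: "(block_rev ?J \<circ> block_rev ?I) y < (block_rev ?J \<circ> block_rev ?I) x"
    let ?x = "block_rev ?I x" and ?y = "block_rev ?I y"
    \<comment> \<open>A pair \<open>?x < ?y\<close> inverted by \<open>block_rev ?J\<close> lies
      within \<open>?I\<close>, so the involution \<open>block_rev ?I\<close> would send it back to
      \<open>y < x\<close>.\<close>
    have "?y < ?x"
    proof (rule ccontr)
      assume "\<not> ?y < ?x"
      then have "?x < ?y" using less by (metis comp_apply less_irrefl linorder_neqE_nat)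
      then have "{?x..<?y} \<subseteq> ?I"
        using less J'.block_rev_less_iff[of ?x ?y] subset_trans[OF _ J'] unfolding comp_apply by blast
      then have "y < x" using I.block_rev_less_iff[OF \<open>?x < ?y\<close>] I.block_rev_invol by metis
      then show False using \<open>x < y\<close> by simp
    qed
    then show "block_rev ?J ((block_rev ?J \<circ> block_rev ?I) y)
        < block_rev ?J ((block_rev ?J \<circ> block_rev ?I) x)"
      by (simp only: comp_apply J'.block_rev_invol)
  qed
  have 1: "act N ?m \<circ> act_longest N J = act_longest N ?I"
    unfolding act_comp[OF perm J.block_rev_permutes la1] by (simp add: fun_eq_iff comp_def)
  have "block_rev ?J \<circ> ?m = block_rev ?I" unfolding conj
    by (rule ext) (simp only: comp_apply J'.block_rev_invol)
  then have 2: "act_longest N ?J \<circ> act N ?m = act_longest N ?I"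
    using act_comp[OF J'.block_rev_permutes perm la2] by simp
  show ?thesis using 1 2 by (metis comp_assoc)
qed

text \<open>The first half twist reflects \<open>J\<close> inside the interval and the second
  reflects it back: an instance of the centrality of the full twist.\<close>

lemma act_longest_square_commute:
  assumes cd: "1 \<le> c" "c \<le> d" "d \<le> N" and J: "J \<subseteq> {c..<d}"
  shows "act_longest N {c..<d} \<circ> act_longest N {c..<d} \<circ> act_longest N J
    = act_longest N J \<circ> (act_longest N {c..<d} \<circ> act_longest N {c..<d})"
proof -
  let ?f = "\<lambda>j. c + d - 1 - j"
  have "?f ` J \<subseteq> {c..<d}" using J by (rule reflect_subset)
  moreover have "?f ` ?f ` J = J"
  proof -
    have "?f (?f j) = j" if "j \<in> J" for j using that J by auto
    then show ?thesis by (simp add: image_image)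
  qed
  ultimately show ?thesis
    using act_longest_conj_flip[OF cd J] act_longest_conj_flip[OF cd, of "?f ` J"]
    by (metis comp_assoc)
qed

lemma act_swap:
  assumes "u permutes {1..N}" "v permutes {1..N}" "v' permutes {1..N}"
    and "len_add N u v" "len_add N v' u" "u \<circ> v = v' \<circ> u"
  shows "act N u \<circ> act N v = act N v' \<circ> act N u"
  using assms by (simp add: act_comp)

section \<open>Splitting half twists and joining crossings\<close>

lemma seg_cross_less:
  assumes "x < y" "c \<le> x \<and> y < c + m \<or> c + m \<le> x \<and> y < c + m + l"
  shows "seg_cross c m l x < seg_cross c m l y"
  using assms by (auto simp: seg_cross_def intro: diff_less_mono)

lemma seg_cross_inversion:
  assumes "x < y" "seg_cross c m l y < seg_cross c m l x"
  shows "c \<le> x \<and> x < c + m \<and> c + m \<le> y \<and> y < c + m + l"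
  using assms unfolding seg_cross_def by (simp split: if_splits)

lemma seg_rev_comp_adjacent:
  assumes "1 \<le> i" "1 \<le> j"
  shows "(seg_rev c (c + i - 1) \<circ> seg_rev (c + i) (c + i + j - 1)) x =
    (if c \<le> x \<and> x < c + i then 2 * c + i - 1 - x
     else if c + i \<le> x \<and> x < c + i + j then 2 * c + 2 * i + j - 1 - x else x)"
proof -
  have "x \<le> c + i + j - 1 \<longleftrightarrow> x < c + i + j" "x \<le> c + i - 1 \<longleftrightarrow> x < c + i" using assms by auto
  then show ?thesis using assms by (auto simp: seg_rev_def)
qed

lemma seg_rev_comp_adjacent_inversion:
  assumes "1 \<le> i" "1 \<le> j" and "x < y"
    and "(seg_rev c (c + i - 1) \<circ> seg_rev (c + i) (c + i + j - 1)) y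
      < (seg_rev c (c + i - 1) \<circ> seg_rev (c + i) (c + i + j - 1)) x"
  shows "c \<le> x \<and> y < c + i \<or> c + i \<le> x \<and> y < c + i + j"
  using assms(1-3) assms(4)[unfolded seg_rev_comp_adjacent[OF assms(1,2)]]
  by (simp split: if_splits)

text \<open>Lengths add because the crossing inverts only pairs from different blocks and the block
  twists only pairs within one. The rightmost factor acts first, so the blocks have sizes
  \<open>l\<close>, \<open>m\<close> once crossed and \<open>m\<close>, \<open>l\<close>
  before.\<close>

lemma act_longest_split:
  assumes "1 \<le> c" "1 \<le> m" "1 \<le> l" "c + m + l \<le> N + 1"
  shows "act_longest N {c..<c + m + l - 1}
      = act_longest N {c..<c + l - 1} \<circ> act_longest N {c + l..<c + l + m - 1} \<circ> act N (seg_cross c m l)"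
    and "act_longest N {c..<c + m + l - 1}
      = act N (seg_cross c m l) \<circ> act_longest N {c..<c + m - 1} \<circ> act_longest N {c + m..<c + m + l - 1}"
proof -
  have pair: "act_longest N {c..<c + i - 1} \<circ> act_longest N {c + i..<c + i + j - 1}
      = act N (seg_rev c (c + i - 1) \<circ> seg_rev (c + i) (c + i + j - 1))"
    and perm: "seg_rev c (c + i - 1) \<circ> seg_rev (c + i) (c + i + j - 1) permutes {1..N}"
    if "1 \<le> i" "1 \<le> j" "c + i + j \<le> N + 1" for i j
  proof -
    have g: "generator_set N {c..<c + i - 1}" "generator_set N {c + i..<c + i + j - 1}"
      using that assms(1) by (unfold_locales; auto)+
    have s: "separated {c..<c + i - 1} {c + i..<c + i + j - 1}"
      by (auto simp: separated_def)
    show "act_longest N {c..<c + i - 1} \<circ> act_longest N {c + i..<c + i + j - 1}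
      = act N (seg_rev c (c + i - 1) \<circ> seg_rev (c + i) (c + i + j - 1))"
      using act_longest_Un[OF g s] block_rev_Un[OF g s] that assms(1)
      by (simp add: block_rev_interval)
    show "seg_rev c (c + i - 1) \<circ> seg_rev (c + i) (c + i + j - 1) permutes {1..N}"
      using that assms(1) by (intro permutes_compose seg_rev_permutes) auto
  qed
  have bound: "c + l + m \<le> N + 1" using assms(4) by simp
  have x: "seg_cross c m l permutes {1..N}" using assms by (intro seg_cross_permutes)
  have rev: "block_rev {c..<c + m + l - 1} = seg_rev c (c + m + l - 1)"
    using assms by (intro block_rev_interval) auto
  have "act N (seg_rev c (c + l - 1) \<circ> seg_rev (c + l) (c + l + m - 1)) \<circ> act N (seg_cross c m l)
      = act N (seg_rev c (c + l - 1) \<circ> seg_rev (c + l) (c + l + m - 1) \<circ> seg_cross c m l)"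
  proof (rule act_comp)
    let ?r = "seg_rev c (c + l - 1) \<circ> seg_rev (c + l) (c + l + m - 1)"
    show "len_add N ?r (seg_cross c m l)"
      unfolding len_add_def
    proof (intro allI impI)
      fix x y assume xy: "x < y" "seg_cross c m l y < seg_cross c m l x"
      note inv = seg_cross_inversion[OF xy]
      have "c \<le> seg_cross c m l y \<and> seg_cross c m l y < c + l
          \<and> c + l \<le> seg_cross c m l x \<and> seg_cross c m l x < c + l + m"
        using inv by (auto simp: seg_cross_def)
      then show "?r (seg_cross c m l y) < ?r (seg_cross c m l x)"
        unfolding seg_rev_comp_adjacent[OF assms(3,2)] by auto
    qed
  qed (use perm[of l m] assms x in auto)
  also have "seg_rev c (c + l - 1) \<circ> seg_rev (c + l) (c + l + m - 1) \<circ> seg_cross c m l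
      = seg_rev c (c + m + l - 1)"
  proof
    fix x
    show "(seg_rev c (c + l - 1) \<circ> seg_rev (c + l) (c + l + m - 1) \<circ> seg_cross c m l) x
      = seg_rev c (c + m + l - 1) x"
    proof -
      consider "x < c" | "c \<le> x" "x < c + m" | "c + m \<le> x" "x < c + m + l" | "c + m + l \<le> x"
        by linarith
      then show ?thesis
        unfolding comp_apply[of _ "seg_cross c m l"] seg_rev_comp_adjacent[OF assms(3,2)]
        by cases (use assms in \<open>auto simp: seg_rev_def seg_cross_def\<close>)
    qed
  qed
  finally show "act_longest N {c..<c + m + l - 1}
      = act_longest N {c..<c + l - 1} \<circ> act_longest N {c + l..<c + l + m - 1} \<circ> act N (seg_cross c m l)"
    unfolding rev pair[OF assms(3,2) bound] by (rule HOL.sym)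
  have "act N (seg_cross c m l) \<circ> act N (seg_rev c (c + m - 1) \<circ> seg_rev (c + m) (c + m + l - 1))
      = act N (seg_cross c m l \<circ> (seg_rev c (c + m - 1) \<circ> seg_rev (c + m) (c + m + l - 1)))"
  proof (rule act_comp)
    let ?r = "seg_rev c (c + m - 1) \<circ> seg_rev (c + m) (c + m + l - 1)"
    show "len_add N (seg_cross c m l) ?r"
      unfolding len_add_def
    proof (intro allI impI)
      fix x y assume xy: "x < y" "?r y < ?r x"
      note inv = seg_rev_comp_adjacent_inversion[OF assms(2,3) xy]
      have "c \<le> ?r y \<and> ?r x < c + m \<or> c + m \<le> ?r y \<and> ?r x < c + m + l"
        using inv xy(1) unfolding seg_rev_comp_adjacent[OF assms(2,3)] by (elim disjE) auto
      then show "seg_cross c m l (?r y) < seg_cross c m l (?r x)"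
        using xy(2) by (intro seg_cross_less)
    qed
  qed (use perm[of m l] assms x in auto)
  also have "seg_cross c m l \<circ> (seg_rev c (c + m - 1) \<circ> seg_rev (c + m) (c + m + l - 1))
      = seg_rev c (c + m + l - 1)"
  proof
    fix x
    show "(seg_cross c m l \<circ> (seg_rev c (c + m - 1) \<circ> seg_rev (c + m) (c + m + l - 1))) x
      = seg_rev c (c + m + l - 1) x"
    proof -
      consider "x < c" | "c \<le> x" "x < c + m" | "c + m \<le> x" "x < c + m + l" | "c + m + l \<le> x"
        by linarith
      then show ?thesis
        unfolding comp_apply[of "seg_cross c m l"] seg_rev_comp_adjacent[OF assms(2,3)]
        by cases (use assms in \<open>auto simp: seg_rev_def seg_cross_def\<close>)
    qed
  qed
  finally show "act_longest N {c..<c + m + l - 1}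
      = act N (seg_cross c m l) \<circ> act_longest N {c..<c + m - 1} \<circ> act_longest N {c + m..<c + m + l - 1}"
    unfolding rev comp_assoc pair[OF assms(2-4)] by (rule HOL.sym)
qed

lemma seg_rev_inversion:
  assumes "x < y" "seg_rev c d y < seg_rev c d x"
  shows "c \<le> x \<and> y \<le> d"
  using assms unfolding seg_rev_def by (simp split: if_splits)

text \<open>A pair inverted by the crossing ends with one point in the front block, now of size
  \<open>l\<close>, and one in the rear block of size \<open>m\<close>; hence the bounds on
  \<open>u\<close>.\<close>

lemma len_add_seg_cross_right:
  assumes "\<And>x y. x < y \<Longrightarrow> c \<le> x \<and> x < c + l \<and> c + l \<le> y \<and> y < c + l + m \<Longrightarrow> u x < u y"
  shows "len_add N u (seg_cross c m l)"
  unfolding len_add_def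
proof (intro allI impI)
  fix x y assume xy: "x < y" "seg_cross c m l y < seg_cross c m l x"
  then show "u (seg_cross c m l y) < u (seg_cross c m l x)"
    using seg_cross_inversion[OF xy] by (intro assms) (auto simp: seg_cross_def)
qed

lemma len_add_seg_rev_right:
  assumes "\<And>x y. x < y \<Longrightarrow> c \<le> x \<Longrightarrow> y \<le> d \<Longrightarrow> u x < u y"
  shows "len_add N u (seg_rev c d)"
  unfolding len_add_def
proof (intro allI impI)
  fix x y assume xy: "x < y" "seg_rev c d y < seg_rev c d x"
  then show "u (seg_rev c d y) < u (seg_rev c d x)"
    using seg_rev_inversion[OF xy] by (intro assms) (auto simp: seg_rev_def)
qed

text \<open>The right-hand \<open>m'\<close> strands cross first, which brings the \<open>l\<close>
  strands next to the left-hand \<open>m\<close>.\<close>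

lemma act_seg_cross_add_left:
  assumes "1 \<le> c" "c + m + m' + l \<le> N + 1"
  shows "act N (seg_cross c m l) \<circ> act N (seg_cross (c + m) m' l) = act N (seg_cross c (m + m') l)"
proof -
  have "seg_cross c m l \<circ> seg_cross (c + m) m' l = seg_cross c (m + m') l"
  proof
    fix x
    consider "x < c" | "c \<le> x" "x < c + m" | "c + m \<le> x" "x < c + m + m'"
      | "c + m + m' \<le> x" "x < c + m + m' + l" | "c + m + m' + l \<le> x"
      by linarith
    then show "(seg_cross c m l \<circ> seg_cross (c + m) m' l) x = seg_cross c (m + m') l x"
      by cases (auto simp: seg_cross_def)
  qed
  moreover have "len_add N (seg_cross c m l) (seg_cross (c + m) m' l)"
    by (rule len_add_seg_cross_right) (auto simp: seg_cross_def)
  ultimately show ?thesis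
    using act_comp[OF seg_cross_permutes[of c m l N] seg_cross_permutes[of "c + m" m' l N]] assms
    by simp
qed

lemma act_seg_cross_add_right:
  assumes "1 \<le> c" "c + m + l + l' \<le> N + 1"
  shows "act N (seg_cross (c + l) m l') \<circ> act N (seg_cross c m l) = act N (seg_cross c m (l + l'))"
proof -
  have "seg_cross (c + l) m l' \<circ> seg_cross c m l = seg_cross c m (l + l')"
  proof
    fix x
    consider "x < c" | "c \<le> x" "x < c + m" | "c + m \<le> x" "x < c + m + l"
      | "c + m + l \<le> x" "x < c + m + l + l'" | "c + m + l + l' \<le> x"
      by linarith
    then show "(seg_cross (c + l) m l' \<circ> seg_cross c m l) x = seg_cross c m (l + l') x"
      by cases (auto simp: seg_cross_def)
  qed
  moreover have "len_add N (seg_cross (c + l) m l') (seg_cross c m l)"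
    by (rule len_add_seg_cross_right) (auto simp: seg_cross_def)
  ultimately show ?thesis
    using act_comp[OF seg_cross_permutes[of "c + l" m l' N] seg_cross_permutes[of c m l N]] assms
    by simp
qed

text \<open>The crossing translates each half onto the other and inverts no pair inside a half,
  while the half twist inverts only such pairs. Both products are therefore length-additive.\<close>

lemma act_seg_cross_commute:
  assumes cd: "1 \<le> c" "c \<le> d" "d \<le> n"
  shows "act (2 * n) (seg_cross 1 n n) \<circ> act_longest (2 * n) {c..<d}
      = act_longest (2 * n) {n + c..<n + d} \<circ> act (2 * n) (seg_cross 1 n n)"
    and "act (2 * n) (seg_cross 1 n n) \<circ> act_longest (2 * n) {n + c..<n + d}
      = act_longest (2 * n) {c..<d} \<circ> act (2 * n) (seg_cross 1 n n)"
proof -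
  have rev: "block_rev {c..<d} = seg_rev c d" "block_rev {n + c..<n + d} = seg_rev (n + c) (n + d)"
    using assms by (auto intro!: block_rev_interval)
  let ?x = "seg_cross 1 n n"
  have swap: "?x \<circ> seg_rev c d = seg_rev (n + c) (n + d) \<circ> ?x"
    "?x \<circ> seg_rev (n + c) (n + d) = seg_rev c d \<circ> ?x"
  proof -
    have "(?x \<circ> seg_rev c d) x = (seg_rev (n + c) (n + d) \<circ> ?x) x
      \<and> (?x \<circ> seg_rev (n + c) (n + d)) x = (seg_rev c d \<circ> ?x) x" for x
    proof -
      consider "x < 1" | "1 \<le> x" "x \<le> n" | "n + 1 \<le> x" "x \<le> n + n" | "n + n < x" by linarith
      then show ?thesis using cd by cases (auto simp: seg_cross_def seg_rev_def)
    qed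
    then show "?x \<circ> seg_rev c d = seg_rev (n + c) (n + d) \<circ> ?x"
      "?x \<circ> seg_rev (n + c) (n + d) = seg_rev c d \<circ> ?x"
      unfolding fun_eq_iff by blast+
  qed
  have la: "len_add (2 * n) ?x (seg_rev c d)" "len_add (2 * n) ?x (seg_rev (n + c) (n + d))"
    using cd by (auto intro!: len_add_seg_rev_right seg_cross_less)
  have la': "len_add (2 * n) (seg_rev c d) ?x" "len_add (2 * n) (seg_rev (n + c) (n + d)) ?x"
    using cd by (auto intro!: len_add_seg_cross_right simp: seg_rev_def)
  have perm: "?x permutes {1..2 * n}" "seg_rev c d permutes {1..2 * n}"
    "seg_rev (n + c) (n + d) permutes {1..2 * n}"
    using cd by (intro seg_cross_permutes seg_rev_permutes; simp)+
  show "act (2 * n) ?x \<circ> act_longest (2 * n) {c..<d}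
      = act_longest (2 * n) {n + c..<n + d} \<circ> act (2 * n) ?x"
    unfolding rev by (rule act_swap[OF perm la(1) la'(2) swap(1)])
  show "act (2 * n) ?x \<circ> act_longest (2 * n) {n + c..<n + d}
      = act_longest (2 * n) {c..<d} \<circ> act (2 * n) ?x"
    unfolding rev by (rule act_swap[OF perm(1,3,2) la(2) la'(1) swap(2)])
qed

section \<open>The relation of type \<open>B\<^sub>2\<close>\<close>

text \<open>Read from left to right, the hypotheses are rewrite rules: crossings move to the right,
  commutations sort the half twists, and squares pass the twists of their blocks.\<close>

lemma braid_relation_of_crossing:
  fixes a b t t' p p' q q' \<chi> :: "'a \<Rightarrow> 'a"
  assumes ab: "a \<circ> b = t \<circ> p' \<circ> q' \<circ> t \<circ> \<chi>"
    and ba: "b \<circ> a = q \<circ> t' \<circ> t' \<circ> p \<circ> \<chi>"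
    and cross: "\<chi> \<circ> t = t' \<circ> \<chi>" "\<chi> \<circ> t' = t \<circ> \<chi>" "\<chi> \<circ> p = p' \<circ> \<chi>"
      "\<chi> \<circ> p' = p \<circ> \<chi>" "\<chi> \<circ> q = q' \<circ> \<chi>" "\<chi> \<circ> q' = q \<circ> \<chi>"
    and halves: "t' \<circ> t = t \<circ> t'" "t' \<circ> p = p \<circ> t'" "t' \<circ> q = q \<circ> t'"
      "t \<circ> p' = p' \<circ> t" "t \<circ> q' = q' \<circ> t"
    and blocks: "q \<circ> p = p \<circ> q" "p' \<circ> p = p \<circ> p'" "q' \<circ> p = p \<circ> q'"
      "p' \<circ> q = q \<circ> p'" "q' \<circ> q = q \<circ> q'" "q' \<circ> p' = p' \<circ> q'"
    and squares: "t \<circ> t \<circ> p = p \<circ> (t \<circ> t)" "t \<circ> t \<circ> q = q \<circ> (t \<circ> t)"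
      "t' \<circ> t' \<circ> p' = p' \<circ> (t' \<circ> t')" "t' \<circ> t' \<circ> q' = q' \<circ> (t' \<circ> t')"
  shows "a \<circ> b \<circ> (a \<circ> b) = b \<circ> a \<circ> (b \<circ> a)"
  using cross halves blocks squares unfolding ab ba fun_eq_iff comp_apply by simp

text \<open>Moved to the front, the extra factors give \<open>\<kappa> \<iota>'\<close> and then
  \<open>\<kappa>' \<iota>\<close> on the left side, \<open>\<iota> \<kappa>'\<close> and then
  \<open>\<iota>' \<kappa>\<close> on the right. All four commute.\<close>

lemma braid_relation_twist:
  fixes a b \<iota> \<iota>' \<kappa> \<kappa>' :: "'a \<Rightarrow> 'a"
  assumes braid: "a \<circ> b \<circ> (a \<circ> b) = b \<circ> a \<circ> (b \<circ> a)"
    and a: "a \<circ> \<kappa> = \<kappa> \<circ> a" "a \<circ> \<kappa>' = \<kappa>' \<circ> a" "a \<circ> \<iota> = \<iota>' \<circ> a" "a \<circ> \<iota>' = \<iota> \<circ> a"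
    and b: "b \<circ> \<iota> = \<iota> \<circ> b" "b \<circ> \<iota>' = \<iota>' \<circ> b" "b \<circ> \<kappa> = \<kappa>' \<circ> b" "b \<circ> \<kappa>' = \<kappa> \<circ> b"
    and comm: "\<kappa> \<circ> \<kappa>' = \<kappa>' \<circ> \<kappa>" "\<iota> \<circ> \<kappa>' = \<kappa>' \<circ> \<iota>" "\<iota>' \<circ> \<kappa>' = \<kappa>' \<circ> \<iota>'"
      "\<iota> \<circ> \<kappa> = \<kappa> \<circ> \<iota>" "\<iota>' \<circ> \<kappa> = \<kappa> \<circ> \<iota>'" "\<iota> \<circ> \<iota>' = \<iota>' \<circ> \<iota>"
  shows "a \<circ> \<kappa> \<circ> (b \<circ> \<iota>) \<circ> (a \<circ> \<kappa> \<circ> (b \<circ> \<iota>)) = b \<circ> \<iota> \<circ> (a \<circ> \<kappa>) \<circ> (b \<circ> \<iota> \<circ> (a \<circ> \<kappa>))"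
  using braid a b comm unfolding fun_eq_iff comp_apply by simp

section \<open>Half twists on the four blocks\<close>

lemma separated_intervals: "d < c' \<Longrightarrow> separated {c..<d} {c'..<d'}" "d' < c \<Longrightarrow> separated {c..<d} {c'..<d'}"
  by (auto simp: separated_def)

lemma separated_mono: "separated L K \<Longrightarrow> L' \<subseteq> L \<Longrightarrow> K' \<subseteq> K \<Longrightarrow> separated L' K'"
  unfolding separated_def by blast

lemma generator_set_interval: "1 \<le> c \<Longrightarrow> d \<le> N \<Longrightarrow> generator_set N {c..<d}"
  by unfold_locales auto

lemma act_longest_braid_relation:
  assumes p: "1 \<le> p" and q: "1 \<le> q" and n: "n = p + q"
  defines "a \<equiv> act_longest (2 * n) {1..<n + p}" and "b \<equiv> act_longest (2 * n) {p + 1..<2 * n}"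
  shows "a \<circ> b \<circ> (a \<circ> b) = b \<circ> a \<circ> (b \<circ> a)"
proof -
  let ?N = "2 * n"
  let ?x = "act ?N (seg_cross 1 n n)"
  let ?\<tau> = "act_longest ?N"
  \<comment> \<open>Generators of the two halves, then of the four blocks. Sets in the second half
    are written as translates by \<open>n\<close> to match
    \<open>act_seg_cross_commute\<close>.\<close>
  let ?t1 = "{1..<n}" and ?t2 = "{n + 1..<n + n}"
  let ?p1 = "{1..<p}" and ?q1 = "{p + 1..<n}"
  let ?p2 = "{n + 1..<n + p}" and ?q2 = "{n + (p + 1)..<n + n}"
  \<comment> \<open>The four forms cut \<open>a\<close> after \<open>P\<^sub>1\<close> and after
    \<open>Q\<^sub>1\<close>, and \<open>b\<close> after \<open>P\<^sub>2\<close> and after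
    \<open>Q\<^sub>1\<close>, in this order.\<close>
  have a1: "a = ?\<tau> ?t1 \<circ> ?\<tau> ?p2 \<circ> act ?N (seg_cross 1 p n)"
    and a2: "a = act ?N (seg_cross 1 n p) \<circ> ?\<tau> ?t1 \<circ> ?\<tau> ?p2"
    and b1: "b = ?\<tau> ?q1 \<circ> ?\<tau> ?t2 \<circ> act ?N (seg_cross (p + 1) n q)"
    and b2: "b = act ?N (seg_cross (p + 1) q n) \<circ> ?\<tau> ?q1 \<circ> ?\<tau> ?t2"
  proof -
    have idx: "1 + n = n + 1" "p + 1 + q = n + 1" "n + 1 - 1 = n" "n + 1 + p - 1 = n + p"
      "n + 1 + n - 1 = n + n" "1 + p + n - 1 = n + p" "p + 1 + n + q - 1 = n + n"
      using n by simp_all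
    have b: "b = ?\<tau> {p + 1..<n + n}" by (simp add: b_def mult_2)
    have le: "1 + p + n \<le> ?N + 1" "1 + n + p \<le> ?N + 1" "p + 1 + n + q \<le> ?N + 1"
      "p + 1 + q + n \<le> ?N + 1" "1 \<le> n" "1 \<le> p + 1" "1 \<le> (1::nat)"
      using p n by simp_all
    show "a = ?\<tau> ?t1 \<circ> ?\<tau> ?p2 \<circ> act ?N (seg_cross 1 p n)"
      using act_longest_split(1)[OF le(7) p le(5,1)] unfolding a_def idx .
    show "a = act ?N (seg_cross 1 n p) \<circ> ?\<tau> ?t1 \<circ> ?\<tau> ?p2"
      using act_longest_split(2)[OF le(7) le(5) p le(2)] unfolding a_def idx .
    show "b = ?\<tau> ?q1 \<circ> ?\<tau> ?t2 \<circ> act ?N (seg_cross (p + 1) n q)"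
      using act_longest_split(1)[OF le(6) le(5) q le(3)] unfolding b idx .
    show "b = act ?N (seg_cross (p + 1) q n) \<circ> ?\<tau> ?q1 \<circ> ?\<tau> ?t2"
      using act_longest_split(2)[OF le(6) q le(5) le(4)] unfolding b idx .
  qed
  \<comment> \<open>In \<open>a \<circ> b\<close> the crossings of \<open>a1\<close> and
    \<open>b2\<close> meet, in \<open>b \<circ> a\<close> those of \<open>b1\<close> and
    \<open>a2\<close>. Each pair joins to the crossing of the two halves.\<close>
  have x1: "act ?N (seg_cross 1 p n) \<circ> act ?N (seg_cross (p + 1) q n) = ?x"
    using act_seg_cross_add_left[of 1 p q n ?N] n by (simp add: add.commute)
  have x2: "act ?N (seg_cross (p + 1) n q) \<circ> act ?N (seg_cross 1 n p) = ?x"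
    using act_seg_cross_add_right[of 1 n p q ?N] n by (simp add: add.commute)
  have cross: "?x \<circ> ?\<tau> ?t1 = ?\<tau> ?t2 \<circ> ?x" "?x \<circ> ?\<tau> ?t2 = ?\<tau> ?t1 \<circ> ?x"
    "?x \<circ> ?\<tau> ?p1 = ?\<tau> ?p2 \<circ> ?x" "?x \<circ> ?\<tau> ?p2 = ?\<tau> ?p1 \<circ> ?x"
    "?x \<circ> ?\<tau> ?q1 = ?\<tau> ?q2 \<circ> ?x" "?x \<circ> ?\<tau> ?q2 = ?\<tau> ?q1 \<circ> ?x"
    using p q n by (intro act_seg_cross_commute; simp)+
  have comm: "?\<tau> {c..<d} \<circ> ?\<tau> {c'..<d'} = ?\<tau> {c'..<d'} \<circ> ?\<tau> {c..<d}"
    if "1 \<le> c" "1 \<le> c'" "d \<le> ?N" "d' \<le> ?N" "d < c' \<or> d' < c" for c d c' d'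
    using that by (intro act_longest_commute generator_set_interval) (auto simp: separated_def)
  show ?thesis
  proof (rule braid_relation_of_crossing[where t = "?\<tau> ?t1" and t' = "?\<tau> ?t2"
        and p = "?\<tau> ?p1" and p' = "?\<tau> ?p2" and q = "?\<tau> ?q1" and q' = "?\<tau> ?q2" and \<chi> = ?x])
    have "a \<circ> b = ?\<tau> ?t1 \<circ> ?\<tau> ?p2 \<circ> (act ?N (seg_cross 1 p n) \<circ> act ?N (seg_cross (p + 1) q n))
        \<circ> ?\<tau> ?q1 \<circ> ?\<tau> ?t2"
      unfolding a1 b2 by (simp only: comp_assoc)
    also have "\<dots> = ?\<tau> ?t1 \<circ> ?\<tau> ?p2 \<circ> ?\<tau> ?q2 \<circ> ?\<tau> ?t1 \<circ> ?x"
      unfolding x1 using cross unfolding fun_eq_iff comp_apply by simp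
    finally show "a \<circ> b = ?\<tau> ?t1 \<circ> ?\<tau> ?p2 \<circ> ?\<tau> ?q2 \<circ> ?\<tau> ?t1 \<circ> ?x" .
    have "b \<circ> a = ?\<tau> ?q1 \<circ> ?\<tau> ?t2 \<circ> (act ?N (seg_cross (p + 1) n q) \<circ> act ?N (seg_cross 1 n p))
        \<circ> ?\<tau> ?t1 \<circ> ?\<tau> ?p2"
      unfolding a2 b1 by (simp only: comp_assoc)
    also have "\<dots> = ?\<tau> ?q1 \<circ> ?\<tau> ?t2 \<circ> ?\<tau> ?t2 \<circ> ?\<tau> ?p1 \<circ> ?x"
      unfolding x2 using cross unfolding fun_eq_iff comp_apply by simp
    finally show "b \<circ> a = ?\<tau> ?q1 \<circ> ?\<tau> ?t2 \<circ> ?\<tau> ?t2 \<circ> ?\<tau> ?p1 \<circ> ?x" .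
  qed (rule cross comm act_longest_square_commute; use p q n in auto)+
qed

text \<open>The reflection in \<open>a\<close> carries \<open>J\<close> to \<open>J'\<close>, that
  in \<open>b\<close> carries \<open>K\<close> to \<open>K'\<close>. By symmetry of \<open>J\<close>
  and \<open>K\<close> these are translates by \<open>n\<close>, lying in \<open>P\<^sub>2\<close>
  and \<open>Q\<^sub>1\<close>, and each is fixed by the other reflection.\<close>

lemma act_longest_twisted_braid_relation:
  fixes n k :: nat and J K :: "nat set"
  assumes "n \<ge> 2" and "k \<le> n - 2"
    and J: "J \<subseteq> {1..k}" "J = (\<lambda>j. k + 1 - j) ` J"
    and K: "K \<subseteq> {n + k + 2..2 * n - 1}" "K = (\<lambda>j. 3 * n + k + 1 - j) ` K"
  defines "A \<equiv> act_longest (2 * n) ({1..n + k} \<union> K)"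
    and "B \<equiv> act_longest (2 * n) ({k + 2..2 * n - 1} \<union> J)"
  shows "A \<circ> B \<circ> (A \<circ> B) = B \<circ> A \<circ> (B \<circ> A)"
proof -
  let ?N = "2 * n"
  let ?\<tau> = "act_longest ?N"
  let ?a = "{1..<n + k + 1}" and ?b = "{k + 2..<2 * n}"
  have bounds: "k + 2 \<le> n" using assms by simp
  \<comment> \<open>On the ranges concerned these are \<open>n + k + 1 - j\<close> and
    \<open>2 * n + k + 1 - j\<close>, left in the form that \<open>act_longest_conj_flip\<close>
    produces.\<close>
  define J' where "J' = (\<lambda>j. 1 + (n + k + 1) - 1 - j) ` J"
  define K' where "K' = (\<lambda>j. k + 2 + 2 * n - 1 - j) ` K"
  have J_mem: "1 \<le> j \<and> j \<le> k" if "j \<in> J" for j using that J(1) by auto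
  have K_mem: "n + k + 2 \<le> j \<and> j \<le> 2 * n - 1" if "j \<in> K" for j using that K(1) by auto
  have J'_shift: "J' = (\<lambda>j. n + j) ` J"
  proof -
    have "(\<lambda>j. n + j) ` J = (\<lambda>j. n + (k + 1 - j)) ` J"
      using arg_cong[OF J(2), of "image (\<lambda>j. n + j)"] unfolding image_image .
    also have "\<dots> = J'" unfolding J'_def using J_mem by (intro image_cong) force+
    finally show ?thesis by simp
  qed
  have K'_shift: "K' = (\<lambda>j. j - n) ` K"
  proof -
    have "(\<lambda>j. j - n) ` K = (\<lambda>j. 3 * n + k + 1 - j - n) ` K"
      using arg_cong[OF K(2), of "image (\<lambda>j. j - n)"] unfolding image_image .
    also have "\<dots> = K'" unfolding K'_def by (intro image_cong) auto
    finally show ?thesis by simp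
  qed
  have J'_sub: "J' \<subseteq> {n + 1..<n + k + 1}" unfolding J'_shift using J_mem by force
  have K'_sub: "K' \<subseteq> {k + 2..<n}" unfolding K'_shift using K_mem by force
  have J_sub: "J \<subseteq> {1..<k + 1}" using J(1) by auto
  have K_sub: "K \<subseteq> {n + k + 2..<2 * n}" using K(1) bounds by force
  have flip_a_J': "(\<lambda>j. 1 + (n + k + 1) - 1 - j) ` J' = J"
  proof -
    have "(\<lambda>j. 1 + (n + k + 1) - 1 - j) ` J' = (\<lambda>j. j) ` J"
      unfolding J'_def image_image using J_mem by (intro image_cong) force+
    then show ?thesis by simp
  qed
  have flip_b_K': "(\<lambda>j. k + 2 + 2 * n - 1 - j) ` K' = K"
  proof -
    have "(\<lambda>j. k + 2 + 2 * n - 1 - j) ` K' = (\<lambda>j. j) ` K"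
      unfolding K'_def image_image using K_mem by (intro image_cong) force+
    then show ?thesis by simp
  qed
  have flip_b_J': "(\<lambda>j. k + 2 + 2 * n - 1 - j) ` J' = J'"
  proof -
    have "(\<lambda>j. k + 2 + 2 * n - 1 - j) ` J' = (\<lambda>j. 1 + (n + k + 1) - 1 - j) ` J"
      unfolding J'_shift image_image by (intro image_cong) auto
    then show ?thesis by (simp add: J'_def)
  qed
  have flip_a_K': "(\<lambda>j. 1 + (n + k + 1) - 1 - j) ` K' = K'"
  proof -
    have "(\<lambda>j. 1 + (n + k + 1) - 1 - j) ` K' = (\<lambda>j. k + 2 + 2 * n - 1 - j) ` K"
      unfolding K'_shift image_image using K_mem bounds by (intro image_cong) force+
    then show ?thesis by (simp add: K'_def)
  qed
  have gen: "generator_set ?N L" if "L \<subseteq> {c..<d}" "1 \<le> c" "d \<le> ?N" for L c d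
    using that by unfold_locales (meson generator_set.subset generator_set_interval subset_trans)
  have comm: "?\<tau> L \<circ> ?\<tau> M = ?\<tau> M \<circ> ?\<tau> L"
    if "L \<subseteq> {c..<d}" "M \<subseteq> {c'..<d'}" "1 \<le> c" "1 \<le> c'" "d \<le> ?N" "d' \<le> ?N" "d < c' \<or> d' < c"
    for L M c d c' d'
    using that by (intro act_longest_commute gen[of L c d] gen[of M c' d'])
      (auto intro: separated_mono[OF _ that(1,2)] separated_intervals)
  have eq: "{1..n + k} = ?a" "{k + 2..2 * n - 1} = ?b" using bounds by auto
  have A: "A = ?\<tau> ?a \<circ> ?\<tau> K"
    unfolding A_def eq
    by (intro act_longest_Un gen[of ?a 1 "n + k + 1"] gen[OF K_sub] separated_mono[OF _ subset_refl K_sub]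
        separated_intervals(1)) (use bounds in auto)
  have B: "B = ?\<tau> ?b \<circ> ?\<tau> J"
    unfolding B_def eq
    by (intro act_longest_Un gen[of ?b "k + 2" "2 * n"] gen[OF J_sub] separated_mono[OF _ subset_refl J_sub]
        separated_intervals(2)) (use bounds in auto)
  have flip_a: "?\<tau> ?a \<circ> ?\<tau> L = ?\<tau> ((\<lambda>j. 1 + (n + k + 1) - 1 - j) ` L) \<circ> ?\<tau> ?a" if "L \<subseteq> ?a" for L
    using that bounds by (intro act_longest_conj_flip) auto
  have flip_b: "?\<tau> ?b \<circ> ?\<tau> L = ?\<tau> ((\<lambda>j. k + 2 + 2 * n - 1 - j) ` L) \<circ> ?\<tau> ?b" if "L \<subseteq> ?b" for L
    using that bounds by (intro act_longest_conj_flip) auto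
  have sub_a: "J \<subseteq> ?a" "J' \<subseteq> ?a" "K' \<subseteq> ?a" using J_sub J'_sub K'_sub by force+
  have sub_b: "K \<subseteq> ?b" "J' \<subseteq> ?b" "K' \<subseteq> ?b" using K_sub J'_sub K'_sub bounds by force+
  show ?thesis
    unfolding A B
  proof (rule braid_relation_twist[where \<iota>' = "?\<tau> J'" and \<kappa>' = "?\<tau> K'"])
    \<comment> \<open>Here \<open>p = k + 1\<close>, and \<open>q = n - (k + 1)\<close> is positive
      by \<open>k + 2 \<le> n\<close>.\<close>
    show "?\<tau> ?a \<circ> ?\<tau> ?b \<circ> (?\<tau> ?a \<circ> ?\<tau> ?b) = ?\<tau> ?b \<circ> ?\<tau> ?a \<circ> (?\<tau> ?b \<circ> ?\<tau> ?a)"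
      using act_longest_braid_relation[of "k + 1" "n - (k + 1)" n] bounds by (simp add: ac_simps)
    show "?\<tau> ?a \<circ> ?\<tau> K' = ?\<tau> K' \<circ> ?\<tau> ?a" using flip_a[OF sub_a(3)] unfolding flip_a_K' .
    show "?\<tau> ?a \<circ> ?\<tau> J = ?\<tau> J' \<circ> ?\<tau> ?a" using flip_a[OF sub_a(1)] unfolding J'_def .
    show "?\<tau> ?a \<circ> ?\<tau> J' = ?\<tau> J \<circ> ?\<tau> ?a" using flip_a[OF sub_a(2)] unfolding flip_a_J' .
    show "?\<tau> ?b \<circ> ?\<tau> J' = ?\<tau> J' \<circ> ?\<tau> ?b" using flip_b[OF sub_b(2)] unfolding flip_b_J' .
    show "?\<tau> ?b \<circ> ?\<tau> K = ?\<tau> K' \<circ> ?\<tau> ?b" using flip_b[OF sub_b(1)] unfolding K'_def .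
    show "?\<tau> ?b \<circ> ?\<tau> K' = ?\<tau> K \<circ> ?\<tau> ?b" using flip_b[OF sub_b(3)] unfolding flip_b_K' .
    show "?\<tau> ?a \<circ> ?\<tau> K = ?\<tau> K \<circ> ?\<tau> ?a" by (rule comm[OF subset_refl K_sub]) (use bounds in auto)
    show "?\<tau> ?b \<circ> ?\<tau> J = ?\<tau> J \<circ> ?\<tau> ?b" by (rule comm[OF subset_refl J_sub]) (use bounds in auto)
    show "?\<tau> K \<circ> ?\<tau> K' = ?\<tau> K' \<circ> ?\<tau> K" by (rule comm[OF K_sub K'_sub]) (use bounds in auto)
    show "?\<tau> J \<circ> ?\<tau> K' = ?\<tau> K' \<circ> ?\<tau> J" by (rule comm[OF J_sub K'_sub]) (use bounds in auto)
    show "?\<tau> J' \<circ> ?\<tau> K' = ?\<tau> K' \<circ> ?\<tau> J'" by (rule comm[OF J'_sub K'_sub]) (use bounds in auto)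
    show "?\<tau> J \<circ> ?\<tau> K = ?\<tau> K \<circ> ?\<tau> J" by (rule comm[OF J_sub K_sub]) (use bounds in auto)
    show "?\<tau> J' \<circ> ?\<tau> K = ?\<tau> K \<circ> ?\<tau> J'" by (rule comm[OF J'_sub K_sub]) (use bounds in auto)
    show "?\<tau> J \<circ> ?\<tau> J' = ?\<tau> J' \<circ> ?\<tau> J" by (rule comm[OF J_sub J'_sub]) (use bounds in auto)
  qed
qed

section \<open>Homomorphisms out of presented monoids\<close>

definition word_eval :: "('b, 'm) monoid_scheme \<Rightarrow> ('a \<Rightarrow> 'b) \<Rightarrow> 'a list \<Rightarrow> 'b" where
  "word_eval M f u = foldr (\<lambda>s x. f s \<otimes>\<^bsub>M\<^esub> x) u \<one>\<^bsub>M\<^esub>"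

text \<open>The universal property of a presentation: evaluation of words is constant on congruence
  classes. Generators determine a homomorphism on the carrier, and extensionality does so
  elsewhere.\<close>

lemma presented_monoid_ex1_hom:
  assumes "monoid M" and f: "f \<in> S \<rightarrow> carrier M"
    and rels: "\<And>a b. (a, b) \<in> R \<Longrightarrow> word_eval M f a = word_eval M f b"
  shows "\<exists>!\<phi>. \<phi> \<in> monoid_hom (presented_monoid S R) M \<and> (\<forall>s\<in>S. \<phi> (word_class S R [s]) = f s)"
proof -
  interpret monoid M by fact
  let ?P = "presented_monoid S R"
  have eval_Nil: "word_eval M f [] = \<one>\<^bsub>M\<^esub>"
    and eval_Cons: "word_eval M f (s # u) = f s \<otimes>\<^bsub>M\<^esub> word_eval M f u" for s u
    by (simp_all add: word_eval_def)
  have closed: "word_eval M f u \<in> carrier M" if "u \<in> lists S" for u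
    using that by (induction u) (use f in \<open>auto simp: eval_Nil eval_Cons\<close>)
  have append: "word_eval M f (u @ v) = word_eval M f u \<otimes>\<^bsub>M\<^esub> word_eval M f v"
    if "u \<in> lists S" "v \<in> lists S" for u v
    using that(1)
  proof (induction rule: lists.induct)
    case Nil
    then show ?case using closed[OF that(2)] by (simp add: eval_Nil)
  next
    case (Cons s u)
    then show ?case
      using funcset_mem[OF f Cons.hyps(1)] closed[OF Cons.hyps(2)] closed[OF that(2)]
      by (simp add: eval_Cons m_assoc)
  qed
  have cong: "word_eval M f u = word_eval M f v" if "(u, v) \<in> pres_cong S R" for u v
    using that
  proof induction
    case (rel a b u v)
    then show ?case by (simp add: append rels[OF rel.hyps(1)])
  qed simp_all
  \<comment> \<open>By \<open>cong\<close> the chosen representative is immaterial; the restriction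
    makes \<open>\<phi>\<close> extensional.\<close>
  define \<phi> where "\<phi> = (\<lambda>C\<in>carrier ?P. word_eval M f (SOME u. u \<in> lists S \<and> C = word_class S R u))"
  have \<phi>: "\<phi> (word_class S R u) = word_eval M f u" if u: "u \<in> lists S" for u
  proof -
    let ?v = "SOME v. v \<in> lists S \<and> word_class S R u = word_class S R v"
    have v: "?v \<in> lists S \<and> word_class S R u = word_class S R ?v"
      by (rule someI[of _ u]) (use u in blast)
    then have "word_eval M f u = word_eval M f ?v"
      using word_class_eq_iff[OF u] cong by blast
    moreover have "word_class S R u \<in> carrier ?P" using u by (simp add: carrier_presented_monoid)
    ultimately show ?thesis by (simp add: \<phi>_def)
  qed
  show ?thesis
  proof (rule ex1I[of _ \<phi>], intro conjI ballI)
    have "\<phi> \<in> hom ?P M"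
    proof (rule homI)
      fix x assume "x \<in> carrier ?P"
      then obtain u where u: "u \<in> lists S" "x = word_class S R u"
        unfolding carrier_presented_monoid by blast
      then show "\<phi> x \<in> carrier M" using closed \<phi> by simp
      fix y assume "y \<in> carrier ?P"
      then obtain v where v: "v \<in> lists S" "y = word_class S R v"
        unfolding carrier_presented_monoid by blast
      have "u @ v \<in> lists S" using u v by simp
      then show "\<phi> (x \<otimes>\<^bsub>?P\<^esub> y) = \<phi> x \<otimes>\<^bsub>M\<^esub> \<phi> y"
        using u v by (simp only: mult_presented_monoid \<phi> append)
    qed
    moreover have "\<phi> \<one>\<^bsub>?P\<^esub> = \<one>\<^bsub>M\<^esub>"
      unfolding one_presented_monoid using \<phi>[of "[]"] eval_Nil by simp
    moreover have "\<phi> \<in> extensional (carrier ?P)" unfolding \<phi>_def by (rule restrict_extensional)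
    ultimately show "\<phi> \<in> monoid_hom ?P M" by (simp add: monoid_hom_def)
    show "\<phi> (word_class S R [s]) = f s" if "s \<in> S" for s
      using that f \<phi>[of "[s]"] by (auto simp: eval_Nil eval_Cons Pi_iff)
  next
    fix \<psi> assume "\<psi> \<in> monoid_hom ?P M \<and> (\<forall>s\<in>S. \<psi> (word_class S R [s]) = f s)"
    then have hom: "\<psi> \<in> hom ?P M" and one: "\<psi> \<one>\<^bsub>?P\<^esub> = \<one>\<^bsub>M\<^esub>"
      and ext: "\<psi> \<in> extensional (carrier ?P)" and gen: "\<And>s. s \<in> S \<Longrightarrow> \<psi> (word_class S R [s]) = f s"
      by (auto simp: monoid_hom_def)
    have \<psi>: "\<psi> (word_class S R u) = word_eval M f u" if "u \<in> lists S" for u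
      using that
    proof (induction rule: lists.induct)
      case Nil
      then show ?case using one by (simp add: one_presented_monoid word_eval_def)
    next
      case (Cons s u)
      have s: "[s] \<in> lists S" using Cons.hyps by simp
      have "word_class S R (s # u) = word_class S R [s] \<otimes>\<^bsub>?P\<^esub> word_class S R u"
        using mult_presented_monoid[OF s Cons.hyps(2)] by simp
      moreover have "word_class S R [s] \<in> carrier ?P" "word_class S R u \<in> carrier ?P"
        using s Cons.hyps unfolding carrier_presented_monoid by blast+
      ultimately show ?case
        using hom_mult[OF hom] gen[OF Cons.hyps(1)] Cons.IH by (simp add: word_eval_def)
    qed
    show "\<psi> = \<phi>"
    proof (rule extensionalityI[OF ext])
      show "\<phi> \<in> extensional (carrier ?P)" unfolding \<phi>_def by (rule restrict_extensional)
      show "\<psi> x = \<phi> x" if "x \<in> carrier ?P" for x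
        using that \<phi> \<psi> unfolding carrier_presented_monoid by (elim imageE) (simp only:)
    qed
  qed
qed

theorem theorem5p62:
  fixes n k :: nat and J K :: "nat set"
  assumes "n \<ge> 2" and "k \<le> n - 2"
    and "J \<subseteq> {1..k}" and "J = (\<lambda>j. k + 1 - j) ` J"
    and "K \<subseteq> {n + k + 2..2 * n - 1}" and "K = (\<lambda>j. 3 * n + k + 1 - j) ` K"
  shows "\<exists>!\<phi>. \<phi> \<in> monoid_hom Br_B2 (Br (2 * n)) \<and>
           \<phi> (T_hat 1) = T_lift (2 * n) (longest_elt (2 * n) ({1..n + k} \<union> K)) \<and>
           \<phi> (T_hat 2) = T_lift (2 * n) (longest_elt (2 * n) ({k + 2..2 * n - 1} \<union> J))"
proof -
  interpret monoid "Br (2 * n)" by (rule monoid_Br)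
  let ?L1 = "{1..n + k} \<union> K" and ?L2 = "{k + 2..2 * n - 1} \<union> J"
  interpret L1: generator_set "2 * n" ?L1
    using assms(1,2,5) by unfold_locales auto
  interpret L2: generator_set "2 * n" ?L2
    by unfold_locales (intro Un_least subset_trans[OF assms(3)]; use assms(1,2) in auto)
  define f where "f i = T_lift (2 * n) (longest_elt (2 * n) (if i = 1 then ?L1 else ?L2))" for i :: nat
  have f: "f 1 = T_lift (2 * n) (block_rev ?L1)" "f 2 = T_lift (2 * n) (block_rev ?L2)"
    unfolding f_def L1.longest_elt_eq[symmetric] L2.longest_elt_eq[symmetric] by simp_all
  have closed: "f 1 \<in> carrier (Br (2 * n))" "f 2 \<in> carrier (Br (2 * n))"
    unfolding f by (intro T_lift_in_carrier L1.block_rev_permutes L2.block_rev_permutes)+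
  have act: "act (2 * n) (block_rev ?L1) y = f 1 \<otimes>\<^bsub>Br (2 * n)\<^esub> y"
    "act (2 * n) (block_rev ?L2) y = f 2 \<otimes>\<^bsub>Br (2 * n)\<^esub> y" if "y \<in> carrier (Br (2 * n))" for y
    using that unfolding act_def f by simp_all
  \<comment> \<open>Evaluated at the unit, the identity of operators becomes the equality of the two
    products.\<close>
  have "word_eval (Br (2 * n)) f [1, 2, 1, 2] = word_eval (Br (2 * n)) f [2, 1, 2, 1]"
    using fun_cong[OF act_longest_twisted_braid_relation[OF assms], of "\<one>\<^bsub>Br (2 * n)\<^esub>"] closed
    unfolding comp_apply by (simp only: act m_closed one_closed word_eval_def foldr.simps comp_apply id_apply)
  then have "\<exists>!\<phi>. \<phi> \<in> monoid_hom (presented_monoid {1, 2} B2_rels) (Br (2 * n))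
      \<and> (\<forall>s\<in>{1, 2}. \<phi> (word_class {1, 2} B2_rels [s]) = f s)"
    using closed by (intro presented_monoid_ex1_hom monoid_Br) (auto simp: B2_rels_def)
  moreover have "f 1 = T_lift (2 * n) (longest_elt (2 * n) ?L1)"
    "f 2 = T_lift (2 * n) (longest_elt (2 * n) ?L2)"
    by (simp_all add: f_def)
  ultimately show ?thesis
    unfolding Br_B2_def T_hat_def by simp
qed

end
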